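(* Let $A=\begin{pmatrix}a&b\\c&d\end{pmatrix}$ with $a,b,c,d\in\mathbb{R}$, $ad-bc=1$, and let $f_1,f_2\in L^2(\mathbb{R}^{3,1},C\ell_{3,1})$. Then $$\langle\mathcal{L}_A[f_1],\mathcal{L}_A[f_2]\rangle_{L^2(\mathbb{R}^{3,1},C\ell_{3,1})}=2\pi\,\langle f_1,f_2\rangle_{L^2(\mathbb{R}^{3,1},C\ell_{3,1})}.$$
   Context: $C\ell_{3,1}$ is the real associative algebra generated by $e_t,e_1,e_2,e_3$ with $e_ie_j=-e_je_i$ for $i\neq j$, $e_1^2=e_2^2=e_3^2=1$, $e_t^2=-1$; basis blades $e_A$ are $1,e_t,e_1,e_2,e_3,e_{12},e_{13},e_{23},e_{t1},e_{t2},e_{t3},i_3=e_1e_2e_3,e_{t12},e_{t13},e_{t23},i_{st}=e_ti_3$. For $h\in C\ell_{3,1}$: $\mathrm{Tr}(h)$ is the coefficient of $1$; the principal reverse $\tilde h$ is the real-linear map with $\widetilde{e_A}=e_A^{-1}$ for each basis blade (explicitly, it changes the sign of the $e_t,e_{12},e_{13},e_{23},i_3,i_{st}$ components); $|h|^2=\mathrm{Tr}(h\tilde h)$ is the sum of squares of the coefficients. For $u\in\{e_t,i_3,-i_3\}$, $\boldsymbol{e}^{u\theta}=\cos\theta+u\sin\theta$. Space-time vectors $\boldsymbol{x}=te_t+\underline{x}$, $\underline{x}=x_1e_1+x_2e_2+x_3e_3$, identified with $\mathbb{R}^4$; $\underline{x}\cdot\underline{w}=\sum x_kw_k$, $\underline{x}^2=\underline{x}\cdot\underline{x}$,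 $d^4\boldsymbol{x}=dt\,dx_1dx_2dx_3$. $L^2(\mathbb{R}^{3,1},C\ell_{3,1})$: measurable $f:\mathbb{R}^4\to C\ell_{3,1}$ with $\int|f|^2<\infty$, with inner product $\langle f,g\rangle=\int_{\mathbb{R}^{3,1}}\mathrm{Tr}\big(f(\boldsymbol{x})\widetilde{g(\boldsymbol{x})}\big)d^4\boldsymbol{x}$. LCST: $\mathcal{L}_A[f](\boldsymbol{w})=\int_{\mathbb{R}^{3,1}}\boldsymbol{e}^{-e_tw_tt}f(\boldsymbol{x})\mathcal{K}^A_{i_3}(\underline{x},\underline{w})\,d^4\boldsymbol{x}$ with $\mathcal{K}^A_{i_3}(\underline{x},\underline{w})=\frac{1}{(2\pi b)^{3/2}}\boldsymbol{e}^{i_3\left(\frac{a}{2b}\underline{x}^2+\frac{d}{2b}\underline{w}^2-\frac{\underline{x}\cdot\underline{w}}{b}\right)}$ if $b\neq0$, and $\sqrt{d}\,\boldsymbol{e}^{i_3\frac{cd}{2}\underline{w}^2}\delta(\underline{x}-d\underline{w})$ if $b=0$.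
   Formalization: For b=0 the kernel factor √d is replaced by |d|^{3/2} (with √d the identity fails, e.g. b=c=0, d=2, a=1/2, and √d is undefined for d<0); for b≠0, (2πb)^{3/2} is read as (2π|b|)^{3/2}; L_A[f] is the L²-limit of truncated integrals, since the integral may diverge. *)

theory Defs
  imports "HOL-Analysis.Analysis"
begin

text \<open>A basis blade is encoded by the set of generators it contains, as a quadruple
  (has e_t, has e_1, has e_2, has e_3); generator indices are 0 = t, 1, 2, 3, and
  every blade is the product of its generators in increasing index order
  (e.g. i_3 = e_1 e_2 e_3, i_st = e_t e_1 e_2 e_3, e_t12 = e_t e_1 e_2).\<close>

type_synonym blade = "bool \<times> bool \<times> bool \<times> bool"
type_synonym cl31 = "real ^ blade"

definition bl_mem :: "blade \<Rightarrow> nat \<Rightarrow> bool" where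
  "bl_mem A k = (case A of (a0, a1, a2, a3) \<Rightarrow>
      (if k = 0 then a0 else if k = 1 then a1 else if k = 2 then a2 else if k = 3 then a3 else False))"

definition bl_xor :: "blade \<Rightarrow> blade \<Rightarrow> blade" where
  "bl_xor A B = (case A of (a0, a1, a2, a3) \<Rightarrow> case B of (b0, b1, b2, b3) \<Rightarrow>
      (a0 \<noteq> b0, a1 \<noteq> b1, a2 \<noteq> b2, a3 \<noteq> b3))"

definition gen_sq :: "nat \<Rightarrow> real" where
  "gen_sq k = (if k = 0 then -1 else 1)"

text \<open>e_A e_B = bl_sign A B * e_(A xor B), using anticommutation of distinct generators.\<close>
definition bl_sign :: "blade \<Rightarrow> blade \<Rightarrow> real" where
  "bl_sign A B =
     (-1) ^ card {(i, j). i < (4::nat) \<and> j < 4 \<and> j < i \<and> bl_mem A i \<and> bl_mem B j}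
     * (\<Prod>k<(4::nat). if bl_mem A k \<and> bl_mem B k then gen_sq k else 1)"

definition cl_basis :: "blade \<Rightarrow> cl31" where
  "cl_basis A = (\<chi> B. if B = A then 1 else 0)"

definition cl_mult :: "cl31 \<Rightarrow> cl31 \<Rightarrow> cl31" where
  "cl_mult x y = (\<Sum>A\<in>UNIV. \<Sum>B\<in>UNIV. (bl_sign A B * x $ A * y $ B) *\<^sub>R cl_basis (bl_xor A B))"

definition cl_one :: cl31 where "cl_one = cl_basis (False, False, False, False)"
definition e_t :: cl31 where "e_t = cl_basis (True, False, False, False)"
definition i3 :: cl31 where "i3 = cl_basis (False, True, True, True)"

definition cl_tr :: "cl31 \<Rightarrow> real" where
  "cl_tr h = h $ (False, False, False, False)"

text \<open>Principal reverse: e_A \<mapsto> e_A^{-1}; since e_A e_A = bl_sign A A = \<plusminus>1,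
  e_A^{-1} = bl_sign A A * e_A.\<close>
definition cl_rev :: "cl31 \<Rightarrow> cl31" where
  "cl_rev h = (\<Sum>A\<in>UNIV. (h $ A) *\<^sub>R (bl_sign A A *\<^sub>R cl_basis A))"

definition cl_abs2 :: "cl31 \<Rightarrow> real" where
  "cl_abs2 h = cl_tr (cl_mult h (cl_rev h))"

definition cl_exp :: "cl31 \<Rightarrow> real \<Rightarrow> cl31" where
  "cl_exp u \<theta> = cos \<theta> *\<^sub>R cl_one + sin \<theta> *\<^sub>R u"

type_synonym stvec = "real \<times> (real ^ 3)"

definition L2 :: "(stvec \<Rightarrow> cl31) \<Rightarrow> bool" where
  "L2 f \<longleftrightarrow> f \<in> borel_measurable lebesgue \<and> integrable lebesgue (\<lambda>z. cl_abs2 (f z))"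

definition L2_inner :: "(stvec \<Rightarrow> cl31) \<Rightarrow> (stvec \<Rightarrow> cl31) \<Rightarrow> real" where
  "L2_inner f g = (\<integral>z. cl_tr (cl_mult (f z) (cl_rev (g z))) \<partial>lebesgue)"

definition lcst_kernel :: "real \<Rightarrow> real \<Rightarrow> real \<Rightarrow> real ^ 3 \<Rightarrow> real ^ 3 \<Rightarrow> cl31" where
  "lcst_kernel a b d x w =
     (1 / (2 * pi * \<bar>b\<bar>) powr (3/2)) *\<^sub>R
       cl_exp i3 (a / (2*b) * (x \<bullet> x) + d / (2*b) * (w \<bullet> w) - (x \<bullet> w) / b)"

text \<open>The defining integral, truncated to |(t,x)| \<le> R (b \<noteq> 0) resp. |t| \<le> R (b = 0,
  where the delta kernel has been integrated out in x).  For f in L^2 these are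
  well defined and the LCST of f is their L^2-limit as R \<rightarrow> \<infinity>.\<close>
definition lcst_trunc ::
  "real \<Rightarrow> real \<Rightarrow> real \<Rightarrow> real \<Rightarrow> real \<Rightarrow> (stvec \<Rightarrow> cl31) \<Rightarrow> stvec \<Rightarrow> cl31" where
  "lcst_trunc a b c d R f = (\<lambda>(wt, w).
     if b \<noteq> 0 then
       (\<integral>z. indicator (cball 0 R) z *\<^sub>R
            (case z of (t, x) \<Rightarrow>
               cl_mult (cl_mult (cl_exp e_t (- (wt * t))) (f (t, x))) (lcst_kernel a b d x w))
          \<partial>lebesgue)
     else
       (\<integral>t. indicator {-R..R} t *\<^sub>R
            cl_mult (cl_mult (cl_exp e_t (- (wt * t))) (f (t, d *\<^sub>R w)))
                    ((\<bar>d\<bar> powr (3/2)) *\<^sub>R cl_exp i3 (c * d / 2 * (w \<bullet> w)))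
          \<partial>lebesgue))"

definition is_lcst :: "real \<Rightarrow> real \<Rightarrow> real \<Rightarrow> real \<Rightarrow> (stvec \<Rightarrow> cl31) \<Rightarrow> (stvec \<Rightarrow> cl31) \<Rightarrow> bool" where
  "is_lcst a b c d f g \<longleftrightarrow> L2 g \<and>
     ((\<lambda>R. \<integral>\<^sup>+ z. ennreal (cl_abs2 (lcst_trunc a b c d R f z - g z)) \<partial>lebesgue) \<longlongrightarrow> 0) at_top"

end

theory Submission
  imports Defs "HOL-Probability.Characteristic_Functions"
begin

text \<open>Left multiplication by \<open>e_t\<close> and right multiplication by \<open>i_3\<close> are commuting isometric complex
  structures on the algebra. On the subspace where they agree and on the one where they are opposite, the
  transform acts coordinatewise by scalar operators: for \<open>b \<noteq> 0\<close> a chirp, the Fourier transform of \<open>\<real>\<^sup>4\<close>, a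
  dilation by \<open>\<plusminus> 1 / b\<close> in space and another chirp; for \<open>b = 0\<close> a dilation by \<open>d\<close> in space, a chirp and the
  Fourier transform in time. So the norm identity reduces to the scalar Plancherel theorem, where all but one
  of the factors \<open>2 * pi\<close> are absorbed by the kernel.

  Plancherel's theorem: damping \<open>|F h|\<^sup>2\<close> by a Gaussian gives the heat kernel form of \<open>h\<close>, which Schur's test
  bounds by \<open>|h|\<^sup>2\<close>; this is \<open>\<le>\<close>. Letting the damping tend to 0 against a bounded continuous \<open>k\<close> gives
  Parseval's identity for \<open>h\<close> and \<open>k\<close>, and expanding \<open>0 \<le> |F (h - k)|\<^sup>2\<close> for \<open>k\<close> close to \<open>h\<close> in \<open>L\<^sup>2\<close> gives
  \<open>\<ge>\<close>.

  By the norm identity the truncated transforms of \<open>f\<close> form an \<open>L\<^sup>2\<close> Cauchy family; the identity passes to their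
  limits, and polarization gives the inner products.\<close>

subsection \<open>Two commuting complex structures\<close>

text \<open>The two exponentials stand on opposite sides of the signal, and \<open>e_t\<close> and
  \<open>i3\<close> anticommute in the algebra, so no single complex scalar action covers both. Left
  and right multiplication commute nevertheless, by associativity, and that is all the splitting
  needs.

  Two measure-theoretic obstacles shape the rest. First, a signal is only Lebesgue measurable, and
  for \<open>b = 0\<close> the transform reads it on the slices \<open>x = d w\<close>, where a
  Lebesgue measurable function need not be measurable. The operators are therefore studied on Borel
  functions over \<open>lborel\<close>, where Fubini applies, and equality almost everywhere carries
  the results to \<open>lebesgue\<close>. Second, for \<open>b = 0\<close> the truncation restricts
  time alone; the truncated signal lives on a slab of infinite measure and need not be integrable on
  space-time. There Plancherel is applied in the time variable, on almost every slice.

  The transform is a relation to an L2 limit, so existence of the limit is part of the claim; norms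
  stay in \<open>ennreal\<close> until finiteness is known.\<close>

lemma cl_mult_component:
  "cl_mult x y $ C = (\<Sum>A\<in>UNIV. bl_sign A (bl_xor A C) * x $ A * y $ bl_xor A C)"
proof -
  have "(\<Sum>B\<in>UNIV. bl_sign A B * x $ A * y $ B * (if C = bl_xor A B then 1 else 0)) =
      bl_sign A (bl_xor A C) * x $ A * y $ bl_xor A C" for A
  proof -
    \<comment> \<open>Toggling by \<open>A\<close> is an involution, so exactly one blade
      \<open>B\<close> contributes to the component \<open>C\<close>.\<close>
    have "C = bl_xor A B \<longleftrightarrow> B = bl_xor A C" for B
      by (auto simp: bl_xor_def split: prod.splits)
    then show ?thesis by (simp add: if_distrib cong: if_cong)
  qed
  then show ?thesis
    by (simp add: cl_mult_def cl_basis_def)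
qed

text \<open>As a double sum over indices the number of inversions can be evaluated by the simplifier
  on concrete blades.\<close>

lemma bl_sign_code:
  "bl_sign A B = (- 1) ^ (\<Sum>i<4::nat. \<Sum>j<4::nat. of_bool (j < i \<and> bl_mem A i \<and> bl_mem B j))
     * (\<Prod>k<4::nat. if bl_mem A k \<and> bl_mem B k then gen_sq k else 1)"
proof -
  have "{(i, j). i < (4::nat) \<and> j < (4::nat) \<and> j < i \<and> bl_mem A i \<and> bl_mem B j} =
      (SIGMA i:{..<4}. {j \<in> {..<4}. j < i \<and> bl_mem A i \<and> bl_mem B j})"
    by auto
  then show ?thesis
    by (simp add: bl_sign_def card_SigmaI Int_def)
qed

lemma lessThan_4_nat: "{..<4::nat} = {0, 1, 2, 3}" by auto
text \<open>The generator \<open>e_t\<close> has the lowest index, so it passes no other one, and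
  the only possible sign comes from its square.\<close>

lemma bl_sign_e_t: "bl_sign (True, False, False, False) (b0, b1, b2, b3) = (if b0 then - 1 else 1)"
  unfolding bl_sign_code
  by (simp add: lessThan_4_nat bl_mem_def gen_sq_def)

text \<open>A generator of the left factor passes those generators of \<open>i3\<close> that have
  smaller index: none for indices 0 and 1, one for index 2, two for index 3. The spatial squares are
  1, so only index 2 leaves a sign.\<close>

lemma bl_sign_i3: "bl_sign (a0, a1, a2, a3) (False, True, True, True) =
    (if a2 then - 1 else 1)"
  unfolding bl_sign_code lessThan_4_nat
  by (simp add: bl_mem_def gen_sq_def power_add)

lemma bl_sign_square: "bl_sign A B * bl_sign A B = 1"
proof -
  have "\<bar>bl_sign A B\<bar> = 1"
    by (auto simp add: bl_sign_def abs_mult abs_prod power_abs gen_sq_def intro!: prod.neutral)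
  then show ?thesis
    by (metis abs_mult_self_eq mult_1)
qed

lemma bl_xor_self: "bl_xor A (False, False, False, False) = A"
  by (auto simp: bl_xor_def split: prod.splits)

text \<open>The sign \<open>bl_sign A A\<close> enters twice, through the principal reverse and
  through the scalar part of the product, and squares to 1. From here on the Clifford inner product
  is the Euclidean one of the coefficient vectors.\<close>

lemma cl_tr_mult_rev: "cl_tr (cl_mult x (cl_rev y)) = x \<bullet> y"
proof -
  have "cl_rev y $ A = bl_sign A A * y $ A" for A
    by (simp add: cl_rev_def cl_basis_def if_distrib mult.commute cong: if_cong)
  then have "cl_tr (cl_mult x (cl_rev y)) = (\<Sum>A\<in>UNIV. (bl_sign A A * bl_sign A A) * (x $ A * y $ A))"
    unfolding cl_tr_def cl_mult_component bl_xor_self by (simp add: mult_ac)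
  then show ?thesis
    by (simp add: bl_sign_square inner_vec_def)
qed

lemma cl_abs2_eq_norm: "cl_abs2 x = (norm x)\<^sup>2"
  by (simp add: cl_abs2_def cl_tr_mult_rev power2_norm_eq_inner)

lemma bilinear_cl_mult: "bilinear cl_mult"
  unfolding bilinear_def linear_iff vec_eq_iff
  by (simp add: cl_mult_component algebra_simps sum.distrib sum_distrib_left)

definition left_et :: "cl31 \<Rightarrow> cl31" where "left_et v = cl_mult e_t v"
definition right_i3 :: "cl31 \<Rightarrow> cl31" where "right_i3 v = cl_mult v i3"

lemma linear_left_et: "linear left_et" and linear_right_i3: "linear right_i3"
  using bilinear_cl_mult unfolding bilinear_def left_et_def[abs_def] right_i3_def[abs_def] by blast+

lemma left_et_component: "left_et v $ (a0, a1, a2, a3) = (if a0 then 1 else - 1) * v $ (\<not> a0, a1, a2, a3)"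
proof -
  have "bl_sign A (bl_xor A C) * (if A = B then 1 else 0) * v $ bl_xor A C =
      (if A = B then bl_sign B (bl_xor B C) * v $ bl_xor B C else 0)" for A B C
    by simp
  note * = this
  show ?thesis
    unfolding left_et_def cl_mult_component e_t_def cl_basis_def vec_lambda_beta *
    by (simp add: bl_xor_def bl_sign_e_t)
qed

lemma right_i3_component: "right_i3 v $ (a0, a1, a2, a3) = (if a2 then 1 else - 1) * v $ (a0, \<not> a1, \<not> a2, \<not> a3)"
proof -
  have *: "bl_sign A (bl_xor A (a0, a1, a2, a3)) * v $ A *
      (if bl_xor A (a0, a1, a2, a3) = (False, True, True, True) then 1 else 0) =
      (if A = (a0, \<not> a1, \<not> a2, \<not> a3) then (if a2 then 1 else - 1) * v $ A else 0)" for A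
  proof -
    have "bl_xor A (a0, a1, a2, a3) = (False, True, True, True) \<longleftrightarrow> A = (a0, \<not> a1, \<not> a2, \<not> a3)"
      by (auto simp: bl_xor_def split: prod.splits)
    then show ?thesis
      by (simp add: bl_xor_def bl_sign_i3)
  qed
  show ?thesis
    unfolding right_i3_def cl_mult_component i3_def cl_basis_def vec_lambda_beta * by simp
qed

text \<open>The last identity is an instance of associativity of the product. Like the two squares
  it is read off the components.\<close>

lemma left_et_left_et: "left_et (left_et v) = - v" and right_i3_right_i3: "right_i3 (right_i3 v) = - v" and right_i3_left_et: "right_i3 (left_et v) = left_et (right_i3 v)"
  by (simp_all add: vec_eq_iff split_paired_All left_et_component right_i3_component)

text \<open>Toggling \<open>e_t\<close> is an involution of the blades that exchanges coefficients
  and reverses the sign. Skewness together with the square \<open>- 1\<close> makes the map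
  orthogonal, which \<open>sum_cl_coord\<close> uses.\<close>

lemma left_et_inner: "left_et v \<bullet> w = - (v \<bullet> left_et w)"
  unfolding inner_vec_def sum_negf[symmetric]
  by (rule sum.reindex_bij_witness[of _ "\<lambda>(a0, r). (\<not> a0, r)" "\<lambda>(a0, r). (\<not> a0, r)"])
    (auto simp: left_et_component)

lemma right_i3_inner: "right_i3 v \<bullet> w = - (v \<bullet> right_i3 w)"
  unfolding inner_vec_def sum_negf[symmetric]
  by (rule sum.reindex_bij_witness[of _ "\<lambda>(a0, a1, a2, a3). (a0, \<not> a1, \<not> a2, \<not> a3)"
        "\<lambda>(a0, a1, a2, a3). (a0, \<not> a1, \<not> a2, \<not> a3)"])
    (auto simp: right_i3_component)

lemma cl_mult_one: "cl_mult cl_one v = v" "cl_mult v cl_one = v"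
proof -
  have 1: "bl_sign (False, False, False, False) B = 1" "bl_sign B (False, False, False, False) = 1" for B
  proof -
    have "\<not> bl_mem (False, False, False, False) k" for k by (simp add: bl_mem_def)
    then show "bl_sign (False, False, False, False) B = 1" "bl_sign B (False, False, False, False) = 1"
      by (simp_all add: bl_sign_def)
  qed
  have 2: "(if bl_xor A C = (False, False, False, False) then 1 else 0) = (if A = C then 1 else (0::real))" for A C
    by (auto simp: bl_xor_def split: prod.splits)
  have 3: "bl_xor (False, False, False, False) C = C" "bl_xor C C = (False, False, False, False)" for C
    by (auto simp: bl_xor_def split: prod.splits)
  show "cl_mult cl_one v = v"
    unfolding vec_eq_iff cl_mult_component cl_one_def cl_basis_def
    by (simp add: if_distrib if_distribR 1 3 cong: if_cong)
  show "cl_mult v cl_one = v"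
    unfolding vec_eq_iff cl_mult_component cl_one_def cl_basis_def
    by (simp add: 2) (simp add: if_distrib if_distribR 1 3 cong: if_cong)
qed

lemma cl_exp_sandwich:
  "cl_mult (cl_mult (cl_exp e_t \<theta>) v) (cl_exp i3 \<phi>) =
    cos \<phi> *\<^sub>R (cos \<theta> *\<^sub>R v + sin \<theta> *\<^sub>R left_et v) + sin \<phi> *\<^sub>R right_i3 (cos \<theta> *\<^sub>R v + sin \<theta> *\<^sub>R left_et v)"
  using bilinear_cl_mult
  by (simp add: cl_exp_def scaleR_add_right mult.commute left_et_def right_i3_def bilinear_ladd bilinear_radd bilinear_lmul bilinear_rmul cl_mult_one)

text \<open>A complex coordinate of the part where the two structures agree (\<open>s = 1\<close>) or are opposite
  (\<open>s = - 1\<close>). Letting \<open>q\<close> run through a whole orthonormal basis is redundant and only costs the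
  factor 8 in \<open>sum_cl_coord\<close>.\<close>
definition cl_coord :: "cl31 \<Rightarrow> real \<Rightarrow> cl31 \<Rightarrow> complex" where
  "cl_coord q s v = Complex (q \<bullet> (v - s *\<^sub>R left_et (right_i3 v))) (- (q \<bullet> (left_et v + s *\<^sub>R right_i3 v)))"

lemma linear_cl_coord: "linear (cl_coord q s)"
  unfolding cl_coord_def[abs_def]
  by (rule linearI) (simp_all add: complex_eq_iff linear_add[OF linear_left_et] linear_add[OF linear_right_i3]
    linear_scale[OF linear_left_et] linear_scale[OF linear_right_i3] inner_simps algebra_simps)

lemma cl_coord_left_et: "cl_coord q s (left_et v) = \<i> * cl_coord q s v"
  by (simp add: cl_coord_def complex_eq_iff left_et_left_et right_i3_left_et linear_neg[OF linear_left_et] inner_simps)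

text \<open>On vectors of the form \<open>v - s *\<^sub>R left_et (right_i3 v)\<close> the composite
  of the two structures acts as \<open>- s\<close>, hence \<open>right_i3\<close> acts there as
  \<open>s\<close> times \<open>left_et\<close>.\<close>

lemma cl_coord_right_i3:
  assumes "s * s = 1" shows "cl_coord q s (right_i3 v) = \<i> * s * cl_coord q s v"
  using assms by (simp add: cl_coord_def complex_eq_iff right_i3_right_i3 right_i3_left_et linear_neg[OF linear_left_et] inner_simps
    algebra_simps)

text \<open>Noncommutativity disappears here: in a coordinate both exponentials are scalar phases,
  and the choice \<open>s = - 1\<close> reverses the spatial one.\<close>

lemma cl_coord_sandwich:
  assumes "s * s = 1"
  shows "cl_coord q s (cl_mult (cl_mult (cl_exp e_t \<theta>) v) (cl_exp i3 \<phi>)) =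
    cis \<theta> * cis (s * \<phi>) * cl_coord q s v"
proof -
  have "s = 1 \<or> s = - 1" using assms by (simp add: square_eq_1_iff)
  then have cis: "cis (s * \<phi>) = cos \<phi> + \<i> * s * sin \<phi>"
    by (auto simp: complex_eq_iff)
  have lin: "linear (cl_coord q s)" by (rule linear_cl_coord)
  show ?thesis
    unfolding cl_exp_sandwich cis
    by (simp add: linear_add[OF lin] linear_scale[OF lin] linear_add[OF linear_right_i3] linear_scale[OF linear_right_i3]
      cl_coord_left_et cl_coord_right_i3[OF assms] complex_eq_iff algebra_simps)
qed

text \<open>For each \<open>s\<close> the real and the imaginary parts both contribute twice the
  squared norm of \<open>v\<close> plus a cross term that is odd in \<open>s\<close>. Summing over
  the two signs cancels the cross terms and leaves the factor 8.\<close>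

lemma sum_cl_coord: "(\<Sum>s\<in>{1, - 1}. \<Sum>q\<in>Basis. (cmod (cl_coord q s v))\<^sup>2) = 8 * (norm v)\<^sup>2"
proof -
  have *: "(\<Sum>q\<in>Basis. (q \<bullet> x)\<^sup>2) = x \<bullet> x" for x :: cl31
    by (subst (2) euclidean_inner) (simp add: power2_eq_square inner_commute)
  have **: "(\<Sum>q\<in>Basis. (cmod (cl_coord q s v))\<^sup>2) =
      (v - s *\<^sub>R left_et (right_i3 v)) \<bullet> (v - s *\<^sub>R left_et (right_i3 v)) + (left_et v + s *\<^sub>R right_i3 v) \<bullet> (left_et v + s *\<^sub>R right_i3 v)" for s
    by (simp add: cl_coord_def cmod_power2 sum.distrib *)
  have "left_et x \<bullet> left_et y = x \<bullet> y" "right_i3 x \<bullet> right_i3 y = x \<bullet> y" for x y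
    by (simp_all add: left_et_inner[of _ "left_et _"] right_i3_inner[of _ "right_i3 _"] left_et_left_et right_i3_right_i3)
  then show ?thesis
    by (simp add: ** inner_simps inner_commute algebra_simps) (simp add: power2_norm_eq_inner)
qed

subsection \<open>Fourier transform of Gaussians\<close>

lemma borel_measurable_cis [measurable]: "cis \<in> borel_measurable borel"
  by (intro borel_measurable_continuous_onI continuous_intros)

lemma cis_sum: "cis (\<Sum>i\<in>A. f i) = (\<Prod>i\<in>A. cis (f i))"
  by (induction A rule: infinite_finite_induct) (simp_all add: cis_mult[symmetric])

text \<open>The parameter is the inverse variance, so a small \<epsilon> means weak damping.\<close>

definition gauss :: "real \<Rightarrow> 'a::euclidean_space \<Rightarrow> real" where
  "gauss \<epsilon> x = exp (- (\<epsilon> / 2 * (x \<bullet> x)))"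

lemma borel_measurable_gauss [measurable]: "gauss \<epsilon> \<in> borel_measurable borel"
  unfolding gauss_def[abs_def] by measurable

lemma gauss_nonneg [simp]: "0 \<le> gauss \<epsilon> x"
  by (simp add: gauss_def)

lemma gauss_le_1: "0 \<le> \<epsilon> \<Longrightarrow> gauss \<epsilon> x \<le> 1"
  by (simp add: gauss_def)

lemma gauss_prod: "gauss \<epsilon> x = (\<Prod>b\<in>Basis. gauss \<epsilon> (x \<bullet> b))"
  unfolding gauss_def exp_sum[OF finite_Basis, symmetric]
  by (subst euclidean_inner) (simp add: sum_distrib_left sum_negf)

lemma integrable_gauss_real:
  fixes \<epsilon> :: real assumes "0 < \<epsilon>"
  shows "integrable lborel (gauss \<epsilon> :: real \<Rightarrow> real)"
proof -
  have "integrable lborel (\<lambda>x. sqrt (2 * pi * (1 / sqrt \<epsilon>)\<^sup>2) * normal_density 0 (1 / sqrt \<epsilon>) x)"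
    using assms by (intro integrable_mult_right integrable_normal_density) simp
  also have "(\<lambda>x. sqrt (2 * pi * (1 / sqrt \<epsilon>)\<^sup>2) * normal_density 0 (1 / sqrt \<epsilon>) x) = gauss \<epsilon>"
    using assms by (auto simp: fun_eq_iff normal_density_def gauss_def power2_eq_square field_simps)
  finally show ?thesis .
qed

text \<open>The substitution \<open>w = u / sqrt \<epsilon>\<close> turns the integral into the
  characteristic function of the standard normal distribution, up to normalization.\<close>

lemma integral_gauss_real:
  fixes \<epsilon> x :: real assumes "0 < \<epsilon>"
  shows "(\<integral>w. cis (- (w * x)) * gauss \<epsilon> w \<partial>lborel) = sqrt (2 * pi / \<epsilon>) * gauss (1 / \<epsilon>) x"
proof -
  let ?c = "1 / sqrt \<epsilon>"
  have "(\<integral>w. cis (- (w * x)) * gauss \<epsilon> w \<partial>lborel) =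
      \<bar>?c\<bar> *\<^sub>R (\<integral>u. cis (- ((0 + ?c * u) * x)) * gauss \<epsilon> (0 + ?c * u) \<partial>lborel)"
    using assms by (intro lborel_integral_real_affine) simp
  also have "(\<integral>u. cis (- ((0 + ?c * u) * x)) * gauss \<epsilon> (0 + ?c * u) \<partial>lborel) =
      (\<integral>u. sqrt (2 * pi) * (std_normal_density u *\<^sub>R iexp (- (x / sqrt \<epsilon>) * u)) \<partial>lborel)"
    using assms by (intro Bochner_Integration.integral_cong refl)
      (simp add: std_normal_density_def gauss_def cis_conv_exp power2_eq_square scaleR_conv_of_real field_simps)
  also have "\<dots> = sqrt (2 * pi) * (\<integral>u. std_normal_density u *\<^sub>R iexp (- (x / sqrt \<epsilon>) * u) \<partial>lborel)"
    by (rule integral_mult_right_zero)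
  also have "(\<integral>u. std_normal_density u *\<^sub>R iexp (- (x / sqrt \<epsilon>) * u) \<partial>lborel) =
      char std_normal_distribution (- (x / sqrt \<epsilon>))"
    by (simp add: char_def integral_density)
  also have "char std_normal_distribution (- (x / sqrt \<epsilon>)) = gauss (1 / \<epsilon>) x"
    using assms by (simp add: char_std_normal_distribution gauss_def power2_eq_square)
  finally show ?thesis
    using assms by (simp add: real_sqrt_divide scaleR_conv_of_real)
qed

definition fourier :: "('a::euclidean_space \<Rightarrow> complex) \<Rightarrow> 'a \<Rightarrow> complex" where
  "fourier h w = (\<integral>x. cis (- (w \<bullet> x)) * h x \<partial>lborel)"

text \<open>Gaussian and phase factor over the basis, and \<open>lborel\<close> is the image of a
  product of one-dimensional Lebesgue measures, so integrability and value both come from the real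
  line.\<close>

lemma
  fixes x :: "'a::euclidean_space"
  assumes "0 < \<epsilon>"
  shows integrable_gauss: "integrable lborel (gauss \<epsilon> :: 'a \<Rightarrow> real)"
    and fourier_gauss: "fourier (\<lambda>w. complex_of_real (gauss \<epsilon> w)) x = sqrt (2 * pi / \<epsilon>) ^ DIM('a) * gauss (1 / \<epsilon>) x"
proof -
  interpret product_sigma_finite "\<lambda>_::'a. lborel :: real measure" ..
  have meas: "(\<lambda>f. \<Sum>b\<in>Basis. f b *\<^sub>R b :: 'a) \<in> (\<Pi>\<^sub>M b\<in>Basis. lborel) \<rightarrow>\<^sub>M borel"
    by measurable
  have "integrable (\<Pi>\<^sub>M b\<in>(Basis::'a set). lborel :: real measure) (\<lambda>f. \<Prod>b\<in>Basis. gauss \<epsilon> (f b))"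
  proof (rule product_integrable_prod)
    show "integrable lborel (gauss \<epsilon> :: real \<Rightarrow> real)"
      using assms by (rule integrable_gauss_real)
  qed simp
  then show "integrable lborel (gauss \<epsilon> :: 'a \<Rightarrow> real)"
    unfolding gauss_prod[where 'a='a, abs_def] by (subst lborel_eq) (simp add: integrable_distr_eq meas inner_sum_left_Basis cong: prod.cong)
  have int: "integrable lborel (\<lambda>w. cis (- (w * (x \<bullet> b))) * gauss \<epsilon> w)" for b
    using integrable_gauss_real[OF assms] by (rule Bochner_Integration.integrable_bound)
      (auto simp: norm_mult)
  have cis: "cis (- (x \<bullet> w)) = (\<Prod>b\<in>Basis. cis (- ((w \<bullet> b) * (x \<bullet> b))))" for w
    by (subst euclidean_inner) (simp add: mult.commute cis_sum[symmetric] sum_negf)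
  have "fourier (\<lambda>w. complex_of_real (gauss \<epsilon> w)) x =
      (\<integral>w. (\<Prod>b\<in>Basis. cis (- ((w \<bullet> b) * (x \<bullet> b))) * gauss \<epsilon> (w \<bullet> b)) \<partial>lborel)"
    unfolding fourier_def gauss_prod[where 'a='a]
    by (simp add: cis prod.distrib)
  also have "\<dots> = (\<integral>f. (\<Prod>b\<in>Basis. cis (- (f b * (x \<bullet> b))) * gauss \<epsilon> (f b)) \<partial>(\<Pi>\<^sub>M b\<in>(Basis::'a set). lborel :: real measure))"
    by (subst lborel_eq) (simp add: integral_distr meas inner_sum_left_Basis cong: prod.cong)
  also have "\<dots> = (\<Prod>b\<in>(Basis::'a set). \<integral>w. cis (- (w * (x \<bullet> b))) * gauss \<epsilon> w \<partial>lborel)"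
    by (rule product_integral_prod[OF finite_Basis int])
  also have "\<dots> = sqrt (2 * pi / \<epsilon>) ^ DIM('a) * gauss (1 / \<epsilon>) x"
    by (simp add: integral_gauss_real[OF assms] gauss_prod[of _ x] prod.distrib)
  finally show "fourier (\<lambda>w. complex_of_real (gauss \<epsilon> w)) x = sqrt (2 * pi / \<epsilon>) ^ DIM('a) * gauss (1 / \<epsilon>) x" .
qed

lemma fourier_measurable [measurable]:
  assumes [measurable]: "h \<in> borel_measurable borel"
  shows "fourier h \<in> borel_measurable borel"
  unfolding fourier_def[abs_def] by measurable

lemma norm_fourier_le:
  assumes "integrable lborel h"
  shows "cmod (fourier h w) \<le> (\<integral>x. cmod (h x) \<partial>lborel)"
proof -
  have "cmod (fourier h w) \<le> (\<integral>x. cmod (cis (- (w \<bullet> x)) * h x) \<partial>lborel)"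
    unfolding fourier_def by (rule integral_norm_bound)
  then show ?thesis by (simp add: norm_mult)
qed

text \<open>The multiplication formula. It rests on the symmetry of \<open>w \<bullet> x\<close> and
  on Fubini: the phase has modulus 1, so the joint integrand is as integrable as the product of
  \<open>h\<close> and \<open>k\<close>.\<close>

lemma fourier_swap:
  fixes h k :: "'a::euclidean_space \<Rightarrow> complex"
  assumes h: "integrable lborel h" and k: "integrable lborel k"
  shows "(\<integral>w. fourier h w * k w \<partial>lborel) = (\<integral>x. h x * fourier k x \<partial>lborel)"
proof -
  have [measurable]: "h \<in> borel_measurable borel" "k \<in> borel_measurable borel"
    using h k by (auto dest: borel_measurable_integrable)
  let ?F = "\<lambda>(w, x). cis (- (w \<bullet> x)) * h x * k w"
  have int: "integrable (lborel \<Otimes>\<^sub>M lborel) ?F"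
  proof (rule lborel_pair.Fubini_integrable)
    show "integrable lborel (\<lambda>w. \<integral>x. cmod (?F (w, x)) \<partial>lborel)"
      using k by (simp add: norm_mult)
    show "AE w in lborel. integrable lborel (\<lambda>x. ?F (w, x))"
    proof (rule AE_I2)
      fix w
      have "integrable lborel (\<lambda>x. k w * h x)" using h by simp
      then show "integrable lborel (\<lambda>x. ?F (w, x))"
        by (rule Bochner_Integration.integrable_bound) (auto simp: norm_mult)
    qed
  qed measurable
  have "(\<integral>w. fourier h w * k w \<partial>lborel) = (\<integral>w. (\<integral>x. ?F (w, x) \<partial>lborel) \<partial>lborel)"
    by (simp add: fourier_def)
  also have "\<dots> = (\<integral>x. (\<integral>w. ?F (w, x) \<partial>lborel) \<partial>lborel)"
    using lborel_pair.Fubini_integral[of "\<lambda>w x. ?F (w, x)"] int by simp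
  also have "\<dots> = (\<integral>x. h x * fourier k x \<partial>lborel)"
    unfolding fourier_def integral_mult_right_zero[symmetric]
    by (intro Bochner_Integration.integral_cong refl) (simp add: inner_commute mult_ac)
  finally show ?thesis .
qed

text \<open>The density of the centred normal distribution with covariance \<epsilon> times the
  identity, that is, the heat kernel at time \<open>\<epsilon> / 2\<close>.\<close>

definition heat :: "real \<Rightarrow> 'a::euclidean_space \<Rightarrow> real" where
  "heat \<epsilon> x = gauss (1 / \<epsilon>) x / sqrt (2 * pi * \<epsilon>) ^ DIM('a)"

lemma borel_measurable_heat [measurable]: "heat \<epsilon> \<in> borel_measurable borel"
  unfolding heat_def[abs_def] by measurable

lemma heat_nonneg [simp]: "0 \<le> \<epsilon> \<Longrightarrow> 0 \<le> heat \<epsilon> x"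
  by (simp add: heat_def)

lemma heat_minus: "heat \<epsilon> (- x) = heat \<epsilon> x"
  by (simp add: heat_def gauss_def)

lemma integrable_heat: "0 < \<epsilon> \<Longrightarrow> integrable lborel (heat \<epsilon>)"
  unfolding heat_def[abs_def] by (simp add: integrable_gauss)

text \<open>The total mass is the Fourier transform of the Gaussian at frequency 0.\<close>

lemma integral_heat:
  assumes "0 < \<epsilon>" shows "integral\<^sup>L lborel (heat \<epsilon> :: 'a::euclidean_space \<Rightarrow> real) = 1"
proof -
  have "complex_of_real (integral\<^sup>L lborel (gauss (1 / \<epsilon>) :: 'a \<Rightarrow> real)) = fourier (\<lambda>w::'a. complex_of_real (gauss (1 / \<epsilon>) w)) 0"
    by (simp add: fourier_def)
  also have "\<dots> = complex_of_real (sqrt (2 * pi * \<epsilon>) ^ DIM('a))"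
    using assms by (simp add: fourier_gauss, simp add: gauss_def)
  finally have "(integral\<^sup>L lborel (gauss (1 / \<epsilon>) :: 'a \<Rightarrow> real)) = sqrt (2 * pi * \<epsilon>) ^ DIM('a)"
    by (simp only: of_real_eq_iff)
  then show ?thesis
    using assms by (simp add: heat_def[abs_def])
qed

lemma fourier_gauss_heat:
  fixes x :: "'a::euclidean_space"
  assumes "0 < \<epsilon>"
  shows "fourier (\<lambda>w. complex_of_real (gauss \<epsilon> w)) x = (2 * pi) ^ DIM('a) * heat \<epsilon> x"
proof -
  have "sqrt (2 * pi / \<epsilon>) * sqrt (2 * pi * \<epsilon>) = 2 * pi"
  proof -
    have "(2 * pi / \<epsilon>) * (2 * pi * \<epsilon>) = (2 * pi)\<^sup>2"
      using assms by (simp add: power2_eq_square)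
    then show ?thesis
      unfolding real_sqrt_mult[symmetric] by (simp only: real_sqrt_abs) simp
  qed
  then have "sqrt (2 * pi / \<epsilon>) ^ DIM('a) * sqrt (2 * pi * \<epsilon>) ^ DIM('a) = (2 * pi) ^ DIM('a)"
    by (metis power_mult_distrib)
  then have "sqrt (2 * pi / \<epsilon>) ^ DIM('a) = (2 * pi) ^ DIM('a) / sqrt (2 * pi * \<epsilon>) ^ DIM('a)"
    using assms by (simp add: field_simps)
  then show ?thesis
    unfolding fourier_gauss[OF assms] heat_def by (simp del: of_real_power flip: of_real_mult)
qed

subsection \<open>Gaussian regularization\<close>

lemma borel_measurable_cnj [measurable]: "cnj \<in> borel_measurable borel"
  by (intro borel_measurable_continuous_onI continuous_intros)

lemma nn_integral_lborel_diff:
  fixes c :: "'a::euclidean_space"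
  assumes [measurable]: "f \<in> borel_measurable borel"
  shows "(\<integral>\<^sup>+y. f (y - c) \<partial>lborel) = (\<integral>\<^sup>+y. f y \<partial>lborel)"
  by (subst (2) lborel_distr_plus[of "- c", symmetric]) (simp add: nn_integral_distr)

lemma integral_lborel_affine:
  fixes f :: "'a::euclidean_space \<Rightarrow> 'b::{banach, second_countable_topology}"
  assumes [measurable]: "f \<in> borel_measurable borel" and c: "c \<noteq> 0"
  shows "(\<integral>x. f x \<partial>lborel) = \<bar>c\<bar> ^ DIM('a) *\<^sub>R (\<integral>x. f (t + c *\<^sub>R x) \<partial>lborel)"
  by (subst lborel_affine[OF c, of t]) (simp add: integral_density integral_distr)

text \<open>The heat kernel is even, so this is the convolution of \<open>k\<close> with it.\<close>

definition heat_conv :: "real \<Rightarrow> ('a::euclidean_space \<Rightarrow> complex) \<Rightarrow> 'a \<Rightarrow> complex" where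
  "heat_conv \<epsilon> k x = (\<integral>y. k y * heat \<epsilon> (y - x) \<partial>lborel)"

lemma borel_measurable_heat_conv [measurable]:
  assumes [measurable]: "k \<in> borel_measurable borel"
  shows "heat_conv \<epsilon> k \<in> borel_measurable borel"
  unfolding heat_conv_def[abs_def] by measurable

lemma fourier_modulated_gauss:
  fixes x y :: "'a::euclidean_space"
  assumes "0 < \<epsilon>"
  shows "fourier (\<lambda>w. cis (w \<bullet> x) * gauss \<epsilon> w) y = (2 * pi) ^ DIM('a) * heat \<epsilon> (y - x)"
proof -
  have "cis (- (y \<bullet> w)) * (cis (w \<bullet> x) * gauss \<epsilon> w) = cis (- ((y - x) \<bullet> w)) * gauss \<epsilon> w" for w
    by (simp add: cis_mult mult.assoc[symmetric] inner_diff_left) (simp add: inner_commute)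
  then show ?thesis
    unfolding fourier_gauss_heat[OF assms, symmetric] fourier_def by (simp only:)
qed

text \<open>\<open>fourier k\<close> is only known to be bounded; the damping makes it integrable,
  so that \<open>fourier_swap\<close> can move the transform away from \<open>h\<close>. A second
  use of \<open>fourier_swap\<close> moves it from \<open>k\<close> to a modulated Gaussian, whose
  transform is a translated heat kernel.\<close>

lemma integral_fourier_gauss:
  fixes h k :: "'a::euclidean_space \<Rightarrow> complex"
  assumes h: "integrable lborel h" and k: "integrable lborel k" and \<epsilon>: "0 < \<epsilon>"
  shows "(\<integral>w. fourier h w * (cnj (fourier k w) * gauss \<epsilon> w) \<partial>lborel) =
    (2 * pi) ^ DIM('a) * (\<integral>x. h x * cnj (heat_conv \<epsilon> k x) \<partial>lborel)"
proof -
  have [measurable]: "h \<in> borel_measurable borel" "k \<in> borel_measurable borel"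
    using h k by (auto dest: borel_measurable_integrable)
  let ?M = "\<lambda>w. cnj (fourier k w) * gauss \<epsilon> w"
  have M: "integrable lborel ?M"
  proof (rule Bochner_Integration.integrable_bound)
    show "integrable lborel (\<lambda>w. (\<integral>x. cmod (k x) \<partial>lborel) * gauss \<epsilon> (w::'a))"
      using \<epsilon> by (simp add: integrable_gauss)
    show "AE w in lborel. norm (?M w) \<le> norm ((\<integral>x. cmod (k x) \<partial>lborel) * gauss \<epsilon> w)"
      using norm_fourier_le[OF k] by (auto simp: norm_mult abs_mult intro!: mult_right_mono order_trans[OF _ abs_ge_self])
  qed measurable
  have *: "fourier ?M x = (2 * pi) ^ DIM('a) * cnj (heat_conv \<epsilon> k x)" for x
  proof -
    have int: "integrable lborel (\<lambda>w. cis (w \<bullet> x) * gauss \<epsilon> w)"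
      using integrable_gauss[OF \<epsilon>, where 'a='a] by (rule Bochner_Integration.integrable_bound) (auto simp: norm_mult)
    have "fourier ?M x = cnj (\<integral>w. fourier k w * (cis (w \<bullet> x) * gauss \<epsilon> w) \<partial>lborel)"
      unfolding fourier_def[of ?M] Bochner_Integration.integral_cnj[symmetric]
      by (intro Bochner_Integration.integral_cong refl) (simp add: cis_cnj inner_commute mult_ac)
    also have "\<dots> = cnj (\<integral>y. k y * ((2 * pi) ^ DIM('a) * heat \<epsilon> (y - x)) \<partial>lborel)"
      by (simp add: fourier_swap[OF k int] fourier_modulated_gauss[OF \<epsilon>])
    also have "(\<integral>y. k y * ((2 * pi) ^ DIM('a) * heat \<epsilon> (y - x)) \<partial>lborel) = (2 * pi) ^ DIM('a) * heat_conv \<epsilon> k x"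
      unfolding heat_conv_def integral_mult_right_zero[symmetric]
      by (intro Bochner_Integration.integral_cong refl) (simp add: mult_ac)
    finally show ?thesis by simp
  qed
  have "(\<integral>w. fourier h w * ?M w \<partial>lborel) = (\<integral>x. h x * ((2 * pi) ^ DIM('a) * cnj (heat_conv \<epsilon> k x)) \<partial>lborel)"
    by (simp add: fourier_swap[OF h M] *)
  also have "\<dots> = (2 * pi) ^ DIM('a) * (\<integral>x. h x * cnj (heat_conv \<epsilon> k x) \<partial>lborel)"
    unfolding integral_mult_right_zero[symmetric]
    by (intro Bochner_Integration.integral_cong refl) (simp add: mult_ac)
  finally show ?thesis .
qed

lemma nn_integral_heat:
  fixes x :: "'a::euclidean_space"
  assumes "0 < \<epsilon>"
  shows "(\<integral>\<^sup>+y. ennreal (heat \<epsilon> (y - x)) \<partial>lborel) = 1"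
proof -
  have "(\<integral>\<^sup>+y. ennreal (heat \<epsilon> (y - x)) \<partial>lborel) = integral\<^sup>N lborel (\<lambda>y::'a. ennreal (heat \<epsilon> y))"
    by (rule nn_integral_lborel_diff) measurable
  also have "\<dots> = 1"
    using assms by (subst nn_integral_eq_integral) (auto simp: integrable_heat integral_heat)
  finally show ?thesis .
qed

text \<open>Schur's test for the heat kernel, by \<open>2|h(x) h(y)| \<le> |h(x)|\<^sup>2 + |h(y)|\<^sup>2\<close>.\<close>
lemma norm_integral_heat_conv_le:
  fixes h :: "'a::euclidean_space \<Rightarrow> complex"
  assumes [measurable]: "h \<in> borel_measurable borel" and \<epsilon>: "0 < \<epsilon>"
  shows "ennreal (cmod (\<integral>x. h x * cnj (heat_conv \<epsilon> h x) \<partial>lborel)) \<le> (\<integral>\<^sup>+x. ennreal ((cmod (h x))\<^sup>2) \<partial>lborel)"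
proof -
  let ?N = "\<integral>\<^sup>+x. ennreal ((cmod (h x))\<^sup>2) \<partial>lborel"
  let ?H = "\<lambda>x y. ennreal (heat \<epsilon> (y - x :: 'a))"
  \<comment> \<open>This covers functions that are not integrable too, because their Bochner
    integral is 0 by convention; \<open>h\<close> is merely measurable here.\<close>
  have norm_le: "ennreal (norm (integral\<^sup>L lborel f)) \<le> (\<integral>\<^sup>+x. ennreal (norm (f x)) \<partial>lborel)" for f :: "'a \<Rightarrow> complex"
    by (cases "integrable lborel f") (auto simp: not_integrable_integral_eq intro: integral_norm_bound_ennreal)
  have "ennreal (cmod (\<integral>x. h x * cnj (heat_conv \<epsilon> h x) \<partial>lborel)) \<le>
      (\<integral>\<^sup>+x. ennreal (cmod (h x)) * ennreal (cmod (heat_conv \<epsilon> h x)) \<partial>lborel)"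
    by (rule order_trans[OF norm_le]) (simp add: norm_mult ennreal_mult')
  also have "\<dots> \<le> (\<integral>\<^sup>+x. ennreal (cmod (h x)) * (\<integral>\<^sup>+y. ennreal (cmod (h y)) * ?H x y \<partial>lborel) \<partial>lborel)"
  proof (intro nn_integral_mono mult_left_mono)
    fix x
    show "ennreal (cmod (heat_conv \<epsilon> h x)) \<le> (\<integral>\<^sup>+y. ennreal (cmod (h y)) * ?H x y \<partial>lborel)"
      unfolding heat_conv_def using \<epsilon>
      by (intro order_trans[OF norm_le]) (simp add: norm_mult ennreal_mult')
  qed simp
  also have "\<dots> = (\<integral>\<^sup>+x. (\<integral>\<^sup>+y. ennreal (cmod (h x)) * (ennreal (cmod (h y)) * ?H x y) \<partial>lborel) \<partial>lborel)"
    by (simp add: nn_integral_cmult)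
  also have "\<dots> \<le> (\<integral>\<^sup>+x. (\<integral>\<^sup>+y. ennreal ((cmod (h x))\<^sup>2 / 2) * ?H x y + ennreal ((cmod (h y))\<^sup>2 / 2) * ?H x y \<partial>lborel) \<partial>lborel)"
  proof (intro nn_integral_mono)
    fix x y
    have "cmod (h x) * cmod (h y) \<le> (cmod (h x))\<^sup>2 / 2 + (cmod (h y))\<^sup>2 / 2"
      using sum_squares_bound[of "cmod (h x)" "cmod (h y)"] by simp
    then have "ennreal (cmod (h x) * cmod (h y)) * ?H x y \<le> ennreal ((cmod (h x))\<^sup>2 / 2 + (cmod (h y))\<^sup>2 / 2) * ?H x y"
      by (intro mult_right_mono ennreal_leI) auto
    then show "ennreal (cmod (h x)) * (ennreal (cmod (h y)) * ?H x y) \<le>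
        ennreal ((cmod (h x))\<^sup>2 / 2) * ?H x y + ennreal ((cmod (h y))\<^sup>2 / 2) * ?H x y"
      by (simp add: ennreal_mult' ennreal_plus distrib_right mult.assoc)
  qed
  also have "\<dots> = (\<integral>\<^sup>+x. (\<integral>\<^sup>+y. ennreal ((cmod (h x))\<^sup>2 / 2) * ?H x y \<partial>lborel) \<partial>lborel) +
      (\<integral>\<^sup>+x. (\<integral>\<^sup>+y. ennreal ((cmod (h y))\<^sup>2 / 2) * ?H x y \<partial>lborel) \<partial>lborel)"
    by (simp add: nn_integral_add)
  also have "(\<integral>\<^sup>+x. (\<integral>\<^sup>+y. ennreal ((cmod (h y))\<^sup>2 / 2) * ?H x y \<partial>lborel) \<partial>lborel) =
      (\<integral>\<^sup>+y. (\<integral>\<^sup>+x. ennreal ((cmod (h y))\<^sup>2 / 2) * ?H y x \<partial>lborel) \<partial>lborel)"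
  \<comment> \<open>Symmetry of the kernel and Tonelli turn this half into the other one.\<close>
  proof -
    have "?H x y = ?H y x" for x y by (metis heat_minus minus_diff_eq)
    then show ?thesis by (subst lborel_pair.Fubini') simp_all
  qed
  also have "(\<integral>\<^sup>+x. (\<integral>\<^sup>+y. ennreal ((cmod (h x))\<^sup>2 / 2) * ?H x y \<partial>lborel) \<partial>lborel) = (\<integral>\<^sup>+x. ennreal ((cmod (h x))\<^sup>2 / 2) \<partial>lborel)"
    by (simp add: nn_integral_cmult nn_integral_heat[OF \<epsilon>])
  also have "(\<integral>\<^sup>+x. ennreal ((cmod (h x))\<^sup>2 / 2) \<partial>lborel) + (\<integral>\<^sup>+x. ennreal ((cmod (h x))\<^sup>2 / 2) \<partial>lborel) = ?N"
    by (subst nn_integral_add[symmetric]) (auto simp flip: ennreal_plus)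
  finally show ?thesis .
qed

lemma gauss_tendsto_1: "(\<lambda>n. gauss (1 / real (Suc n)) x) \<longlonglongrightarrow> 1"
proof -
  have "(\<lambda>n. exp (- (1 / real (Suc n) / 2 * (x \<bullet> x)))) \<longlonglongrightarrow> exp (- (0 / 2 * (x \<bullet> x)))"
    by (intro tendsto_intros LIMSEQ_Suc lim_1_over_n) simp
  then show ?thesis by (simp add: gauss_def)
qed

text \<open>Fatou's lemma, as the damping tends to 0 along \<open>1 / real (Suc n)\<close>. The
  statement is in \<open>ennreal\<close> because finiteness of the left side is a consequence, drawn
  in \<open>integrable_fourier_square\<close>.\<close>

lemma nn_integral_fourier_le:
  fixes h :: "'a::euclidean_space \<Rightarrow> complex"
  assumes h: "integrable lborel h"
  shows "(\<integral>\<^sup>+w. ennreal ((cmod (fourier h w))\<^sup>2) \<partial>lborel) \<le> (2 * pi) ^ DIM('a) * (\<integral>\<^sup>+x. ennreal ((cmod (h x))\<^sup>2) \<partial>lborel)"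
proof -
  have [measurable]: "h \<in> borel_measurable borel"
    using h by (auto dest: borel_measurable_integrable)
  let ?C = "(2 * pi) ^ DIM('a) * (\<integral>\<^sup>+x. ennreal ((cmod (h x))\<^sup>2) \<partial>lborel)"
  have le: "(\<integral>\<^sup>+w. ennreal ((cmod (fourier h w))\<^sup>2 * gauss \<epsilon> w) \<partial>lborel) \<le> ?C" if \<epsilon>: "0 < \<epsilon>" for \<epsilon>
  proof -
    have int: "integrable lborel (\<lambda>w. (cmod (fourier h w))\<^sup>2 * gauss \<epsilon> w)"
    proof (rule Bochner_Integration.integrable_bound)
      show "integrable lborel (\<lambda>w. (\<integral>x. cmod (h x) \<partial>lborel)\<^sup>2 * gauss \<epsilon> (w::'a))"
        using \<epsilon> by (simp add: integrable_gauss)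
      show "AE w in lborel. norm ((cmod (fourier h w))\<^sup>2 * gauss \<epsilon> w) \<le> norm ((\<integral>x. cmod (h x) \<partial>lborel)\<^sup>2 * gauss \<epsilon> w)"
        using norm_fourier_le[OF h] by (auto simp: abs_mult intro!: mult_right_mono power_mono)
    qed measurable
    \<comment> \<open>For \<open>k = h\<close> the left side of
      \<open>integral_fourier_gauss\<close> is the damped energy, a non-negative real, so it may be
      replaced by the modulus of the right side.\<close>
    have "complex_of_real (\<integral>w. (cmod (fourier h w))\<^sup>2 * gauss \<epsilon> w \<partial>lborel) =
        (\<integral>w. fourier h w * (cnj (fourier h w) * gauss \<epsilon> w) \<partial>lborel)"
      unfolding integral_complex_of_real[symmetric] by (simp add: complex_norm_square[symmetric] mult.assoc[symmetric])
    then have "\<bar>\<integral>w. (cmod (fourier h w))\<^sup>2 * gauss \<epsilon> w \<partial>lborel\<bar> =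
        (2 * pi) ^ DIM('a) * cmod (\<integral>x. h x * cnj (heat_conv \<epsilon> h x) \<partial>lborel)"
      unfolding integral_fourier_gauss[OF h h \<epsilon>]
      by (metis (no_types, lifting) norm_of_real norm_mult abs_of_nonneg zero_le_power pi_ge_zero mult_nonneg_nonneg zero_le_numeral of_real_numeral of_real_mult of_real_power)
    then have "(\<integral>\<^sup>+w. ennreal ((cmod (fourier h w))\<^sup>2 * gauss \<epsilon> w) \<partial>lborel) =
        ennreal ((2 * pi) ^ DIM('a) * cmod (\<integral>x. h x * cnj (heat_conv \<epsilon> h x) \<partial>lborel))"
      using int by (subst nn_integral_eq_integral) auto
    also have "\<dots> \<le> ?C"
      using norm_integral_heat_conv_le[of h \<epsilon>] \<epsilon> by (simp add: ennreal_mult' mult_left_mono)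
    finally show ?thesis .
  qed
  have "(\<integral>\<^sup>+w. ennreal ((cmod (fourier h w))\<^sup>2) \<partial>lborel) =
      (\<integral>\<^sup>+w. liminf (\<lambda>n. ennreal ((cmod (fourier h w))\<^sup>2 * gauss (1 / real (Suc n)) w)) \<partial>lborel)"
  proof (intro nn_integral_cong)
    fix w :: 'a
    have "(\<lambda>n. ennreal ((cmod (fourier h w))\<^sup>2 * gauss (1 / real (Suc n)) w)) \<longlonglongrightarrow> ennreal ((cmod (fourier h w))\<^sup>2 * 1)"
      by (intro tendsto_intros gauss_tendsto_1)
    then show "ennreal ((cmod (fourier h w))\<^sup>2) = liminf (\<lambda>n. ennreal ((cmod (fourier h w))\<^sup>2 * gauss (1 / real (Suc n)) w))"
      using lim_imp_Liminf[OF sequentially_bot] by fastforce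
  qed
  also have "\<dots> \<le> liminf (\<lambda>n. \<integral>\<^sup>+w. ennreal ((cmod (fourier h w))\<^sup>2 * gauss (1 / real (Suc n)) w) \<partial>lborel)"
    by (rule nn_integral_liminf) measurable
  also have "\<dots> \<le> ?C"
    by (intro Liminf_le always_eventually allI le) simp_all
  finally show ?thesis .
qed

subsection \<open>Plancherel's theorem\<close>

lemma norm_diff_square_le: "(norm (x - y))\<^sup>2 \<le> 2 * (norm x)\<^sup>2 + 2 * (norm (y::'a::real_normed_vector))\<^sup>2"
proof -
  have "(norm (x - y))\<^sup>2 \<le> (norm x + norm y)\<^sup>2"
    by (intro power_mono norm_triangle_ineq4) simp
  also have "\<dots> \<le> 2 * (norm x)\<^sup>2 + 2 * (norm y)\<^sup>2"
    using sum_squares_bound[of "norm x" "norm y"] by (simp add: power2_sum)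
  finally show ?thesis .
qed

text \<open>Substituting \<open>y = x + sqrt \<epsilon> *\<^sub>R u\<close> moves \<epsilon> from
  the kernel into the argument of \<open>k\<close>. The fixed kernel \<open>heat 1\<close> then
  serves as a majorant for all \<epsilon>.\<close>

lemma heat_conv_affine:
  fixes k :: "'a::euclidean_space \<Rightarrow> complex"
  assumes [measurable]: "k \<in> borel_measurable borel" and \<epsilon>: "0 < \<epsilon>"
  shows "heat_conv \<epsilon> k x = (\<integral>u. k (x + sqrt \<epsilon> *\<^sub>R u) * heat 1 u \<partial>lborel)"
proof -
  have heat: "sqrt \<epsilon> ^ DIM('a) * heat \<epsilon> (sqrt \<epsilon> *\<^sub>R u) = heat 1 u" for u :: 'a
  proof -
    have "(sqrt \<epsilon> *\<^sub>R u) \<bullet> (sqrt \<epsilon> *\<^sub>R u) = \<epsilon> * (u \<bullet> u)"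
      using \<epsilon> by (simp flip: mult.assoc)
    then have "gauss (1 / \<epsilon>) (sqrt \<epsilon> *\<^sub>R u) = gauss 1 u"
      unfolding gauss_def using \<epsilon> by (simp only:) simp
    then show ?thesis
      using \<epsilon> by (simp add: heat_def real_sqrt_mult power_mult_distrib)
  qed
  have "heat_conv \<epsilon> k x = sqrt \<epsilon> ^ DIM('a) *\<^sub>R (\<integral>u. k (x + sqrt \<epsilon> *\<^sub>R u) * heat \<epsilon> (sqrt \<epsilon> *\<^sub>R u) \<partial>lborel)"
    unfolding heat_conv_def using \<epsilon> by (subst integral_lborel_affine[of _ "sqrt \<epsilon>" x]) simp_all
  also have "\<dots> = (\<integral>u. k (x + sqrt \<epsilon> *\<^sub>R u) * heat 1 u \<partial>lborel)"
    unfolding integral_scaleR_right[symmetric] heat[symmetric]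
    by (intro Bochner_Integration.integral_cong refl) (simp add: scaleR_conv_of_real)
  finally show ?thesis .
qed

text \<open>Approximate identity, by dominated convergence with majorant
  \<open>B * heat 1 u\<close>; continuity of \<open>k\<close> gives the pointwise limit at every
  \<open>x\<close>.\<close>

lemma
  fixes k :: "'a::euclidean_space \<Rightarrow> complex"
  assumes cont: "continuous_on UNIV k" and B: "\<And>x. cmod (k x) \<le> B"
  shows norm_heat_conv_le: "0 < \<epsilon> \<Longrightarrow> cmod (heat_conv \<epsilon> k x) \<le> B"
    and heat_conv_tendsto: "(\<lambda>n. heat_conv (1 / real (Suc n)) k x) \<longlonglongrightarrow> k x"
proof -
  have [measurable]: "k \<in> borel_measurable borel"
    using cont by (rule borel_measurable_continuous_onI)
  have int: "integrable lborel (\<lambda>u::'a. B * heat 1 u)"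
    by (simp add: integrable_heat)
  have bound: "norm (k y * heat 1 u) \<le> B * heat 1 u" for y u :: 'a
    using B by (simp add: norm_mult mult_right_mono)
  show "cmod (heat_conv \<epsilon> k x) \<le> B" if "0 < \<epsilon>"
  proof -
    have "cmod (heat_conv \<epsilon> k x) \<le> integral\<^sup>L lborel (\<lambda>u::'a. B * heat 1 u)"
      unfolding heat_conv_affine[OF \<open>k \<in> borel_measurable borel\<close> that]
      using bound by (intro Bochner_Integration.integral_norm_bound_integral int Bochner_Integration.integrable_bound[OF int])
        (auto intro!: AE_I2 intro: order_trans[OF _ abs_ge_self])
    then show ?thesis by (simp add: integral_heat)
  qed
  have "(\<lambda>n. \<integral>u. k (x + sqrt (1 / real (Suc n)) *\<^sub>R u) * heat 1 u \<partial>lborel) \<longlonglongrightarrow>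
      integral\<^sup>L lborel (\<lambda>u::'a. k x * complex_of_real (heat 1 u))"
  proof (rule integral_dominated_convergence[OF _ _ int])
    show "AE u in lborel. (\<lambda>n. k (x + sqrt (1 / real (Suc n)) *\<^sub>R u) * heat 1 u) \<longlonglongrightarrow> k x * heat 1 u"
    proof (intro AE_I2 tendsto_mult tendsto_const)
      fix u :: 'a
      have "(\<lambda>n. x + sqrt (1 / real (Suc n)) *\<^sub>R u) \<longlonglongrightarrow> x + sqrt 0 *\<^sub>R u"
        by (intro tendsto_intros LIMSEQ_Suc lim_1_over_n)
      then show "(\<lambda>n. k (x + sqrt (1 / real (Suc n)) *\<^sub>R u)) \<longlonglongrightarrow> k x"
        using cont by (auto simp: continuous_on_eq_continuous_within intro: isCont_tendsto_compose)
    qed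
  qed (use bound in auto)
  moreover have "integral\<^sup>L lborel (\<lambda>u::'a. k x * complex_of_real (heat 1 u)) = k x"
    by (simp add: integral_heat)
  moreover have "heat_conv (1 / real (Suc n)) k x = (\<integral>u. k (x + sqrt (1 / real (Suc n)) *\<^sub>R u) * heat 1 u \<partial>lborel)" for n
    by (rule heat_conv_affine) simp_all
  ultimately show "(\<lambda>n. heat_conv (1 / real (Suc n)) k x) \<longlonglongrightarrow> k x"
    by (simp only:)
qed

lemma integrable_fourier_square:
  fixes h :: "'a::euclidean_space \<Rightarrow> complex"
  assumes h: "integrable lborel h" and h2: "integrable lborel (\<lambda>x. (cmod (h x))\<^sup>2)"
  shows "integrable lborel (\<lambda>w. (cmod (fourier h w))\<^sup>2)"
    and "(\<integral>w. (cmod (fourier h w))\<^sup>2 \<partial>lborel) \<le> (2 * pi) ^ DIM('a) * (\<integral>x. (cmod (h x))\<^sup>2 \<partial>lborel)"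
proof -
  have [measurable]: "h \<in> borel_measurable borel"
    using h by (auto dest: borel_measurable_integrable)
  have le: "(\<integral>\<^sup>+w. ennreal ((cmod (fourier h w))\<^sup>2) \<partial>lborel) \<le> ennreal ((2 * pi) ^ DIM('a) * (\<integral>x. (cmod (h x))\<^sup>2 \<partial>lborel))"
    using nn_integral_fourier_le[OF h] h2 by (subst ennreal_mult) (auto simp: nn_integral_eq_integral)
  show int: "integrable lborel (\<lambda>w. (cmod (fourier h w))\<^sup>2)"
    unfolding integrable_iff_bounded using order_le_less_trans[OF le ennreal_less_top] by simp
  show "(\<integral>w. (cmod (fourier h w))\<^sup>2 \<partial>lborel) \<le> (2 * pi) ^ DIM('a) * (\<integral>x. (cmod (h x))\<^sup>2 \<partial>lborel)"
    using le int by (simp add: nn_integral_eq_integral ennreal_le_iff)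
qed

lemma norm_mult_cnj_le: "cmod (x * cnj y) \<le> (cmod x)\<^sup>2 + (cmod y)\<^sup>2"
proof -
  have "0 \<le> cmod x * cmod y" by simp
  then show ?thesis
    using sum_squares_bound[of "cmod x" "cmod y"] unfolding norm_mult complex_mod_cnj by linarith
qed

lemma integrable_mult_cnj:
  assumes [measurable]: "h \<in> borel_measurable M" "k \<in> borel_measurable M"
    and "integrable M (\<lambda>x. (cmod (h x))\<^sup>2)" "integrable M (\<lambda>x. (cmod (k x))\<^sup>2)"
  shows "integrable M (\<lambda>x. h x * cnj (k x))"
proof (rule Bochner_Integration.integrable_bound)
  show "integrable M (\<lambda>x. (cmod (h x))\<^sup>2 + (cmod (k x))\<^sup>2)"
    using assms by simp
  show "AE x in M. norm (h x * cnj (k x)) \<le> norm ((cmod (h x))\<^sup>2 + (cmod (k x))\<^sup>2)"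
    by (intro AE_I2 order_trans[OF norm_mult_cnj_le]) simp
qed measurable

text \<open>Both sides of \<open>integral_fourier_gauss\<close> pass to the limit by dominated
  convergence. On the frequency side the majorant is the sum of the two squared transforms,
  integrable by the inequality already proved; on the other side it is the norm of \<open>h\<close>
  times \<open>B\<close>.\<close>

lemma parseval_continuous:
  fixes h k :: "'a::euclidean_space \<Rightarrow> complex"
  assumes h: "integrable lborel h" and h2: "integrable lborel (\<lambda>x. (cmod (h x))\<^sup>2)"
    and k: "integrable lborel k" and k2: "integrable lborel (\<lambda>x. (cmod (k x))\<^sup>2)"
    and cont: "continuous_on UNIV k" and B: "\<And>x. cmod (k x) \<le> B"
  shows "(\<integral>w. fourier h w * cnj (fourier k w) \<partial>lborel) = (2 * pi) ^ DIM('a) * (\<integral>x. h x * cnj (k x) \<partial>lborel)"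
proof -
  have [measurable]: "h \<in> borel_measurable borel" "k \<in> borel_measurable borel"
    using h k by (auto dest: borel_measurable_integrable)
  let ?L = "\<lambda>n. \<integral>w. fourier h w * (cnj (fourier k w) * gauss (1 / real (Suc n)) w) \<partial>lborel"
  have "?L \<longlonglongrightarrow> (\<integral>w. fourier h w * (cnj (fourier k w) * of_real 1) \<partial>lborel)"
  proof (rule integral_dominated_convergence)
    show "integrable lborel (\<lambda>w. (cmod (fourier h w))\<^sup>2 + (cmod (fourier k w))\<^sup>2)"
      using integrable_fourier_square(1)[OF h h2] integrable_fourier_square(1)[OF k k2] by simp
    show "AE w in lborel. norm (fourier h w * (cnj (fourier k w) * gauss (1 / real (Suc n)) w))
        \<le> (cmod (fourier h w))\<^sup>2 + (cmod (fourier k w))\<^sup>2" for n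
    proof (intro AE_I2)
      fix w :: 'a
      have "norm (fourier h w * (cnj (fourier k w) * gauss (1 / real (Suc n)) w)) =
          norm (fourier h w * cnj (fourier k w)) * gauss (1 / real (Suc n)) w"
        by (simp add: norm_mult)
      also have "\<dots> \<le> norm (fourier h w * cnj (fourier k w))"
        by (intro mult_right_le_one_le gauss_le_1) auto
      finally show "norm (fourier h w * (cnj (fourier k w) * gauss (1 / real (Suc n)) w))
          \<le> (cmod (fourier h w))\<^sup>2 + (cmod (fourier k w))\<^sup>2"
        using norm_mult_cnj_le order_trans by blast
    qed
    show "AE w in lborel. (\<lambda>n. fourier h w * (cnj (fourier k w) * gauss (1 / real (Suc n)) w)) \<longlonglongrightarrow>
        fourier h w * (cnj (fourier k w) * of_real 1)"
      by (intro AE_I2 tendsto_intros gauss_tendsto_1)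
  qed measurable
  moreover have "(\<lambda>n. \<integral>x. h x * cnj (heat_conv (1 / real (Suc n)) k x) \<partial>lborel) \<longlonglongrightarrow> (\<integral>x. h x * cnj (k x) \<partial>lborel)"
  proof (rule integral_dominated_convergence)
    show "integrable lborel (\<lambda>x. cmod (h x) * B)"
      using h by simp
    show "AE x in lborel. norm (h x * cnj (heat_conv (1 / real (Suc n)) k x)) \<le> cmod (h x) * B" for n
      using norm_heat_conv_le[OF cont B] by (simp add: norm_mult mult_left_mono)
    show "AE x in lborel. (\<lambda>n. h x * cnj (heat_conv (1 / real (Suc n)) k x)) \<longlonglongrightarrow> h x * cnj (k x)"
      by (intro AE_I2 tendsto_intros heat_conv_tendsto[OF cont B])
  qed measurable
  then have "?L \<longlonglongrightarrow> (2 * pi) ^ DIM('a) * (\<integral>x. h x * cnj (k x) \<partial>lborel)"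
    by (subst integral_fourier_gauss[OF h k]) (auto intro: tendsto_mult_left)
  ultimately show ?thesis
    using LIMSEQ_unique by fastforce
qed

section \<open>Density of bounded continuous functions in L2\<close>

lemma L2_dense_bounded:
  fixes h :: "'a::euclidean_space \<Rightarrow> complex"
  assumes [measurable]: "h \<in> borel_measurable borel" and h2: "integrable lborel (\<lambda>x. (cmod (h x))\<^sup>2)"
  shows "(\<lambda>n. \<integral>x. (cmod (h x - (if norm x \<le> real n \<and> cmod (h x) \<le> real n then h x else 0)))\<^sup>2 \<partial>lborel) \<longlonglongrightarrow> 0"
proof -
  let ?h = "\<lambda>n x. if norm x \<le> real n \<and> cmod (h x) \<le> real n then h x else 0"
  have "(\<lambda>n. \<integral>x. (cmod (h x - ?h n x))\<^sup>2 \<partial>lborel) \<longlonglongrightarrow> integral\<^sup>L lborel (\<lambda>x::'a. 0)"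
  proof (rule integral_dominated_convergence[OF _ _ h2])
    show "AE x in lborel. (\<lambda>n. (cmod (h x - ?h n x))\<^sup>2) \<longlonglongrightarrow> 0"
    proof (rule AE_I2)
      fix x
      have "eventually (\<lambda>n. max (norm x) (cmod (h x)) \<le> real n) sequentially"
        by (rule eventually_compose_filterlim[OF eventually_ge_at_top filterlim_real_sequentially])
      then have "eventually (\<lambda>n. (cmod (h x - ?h n x))\<^sup>2 = 0) sequentially"
        by eventually_elim auto
      then show "(\<lambda>n. (cmod (h x - ?h n x))\<^sup>2) \<longlonglongrightarrow> 0"
        by (rule tendsto_eventually)
    qed
  qed auto
  then show ?thesis by simp
qed

text \<open>By definition of \<open>measurable_on\<close>, \<open>h\<close> is an almost everywhere
  limit of continuous functions, but these have neither a common bound nor a common support. Radial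
  clipping to the disc of radius \<open>M\<close> and a cutoff that is 1 on the ball of radius
  \<open>M\<close> and vanishes beyond \<open>M + 1\<close> supply both. They fix \<open>h\<close>
  itself, so the limit is unchanged and dominated convergence applies.\<close>

lemma bounded_approx_continuous:
  fixes h :: "'a::euclidean_space \<Rightarrow> complex"
  assumes [measurable]: "h \<in> borel_measurable borel" and M: "0 < M" and bnd: "\<And>x. cmod (h x) \<le> M"
    and supp: "\<And>x. M < norm x \<Longrightarrow> h x = 0"
  obtains k where "\<And>n. continuous_on UNIV (k n)" "\<And>n x. cmod (k n x) \<le> M"
    "\<And>n x. M + 1 < norm x \<Longrightarrow> k n x = 0" "(\<lambda>n. \<integral>x. (cmod (h x - k n x))\<^sup>2 \<partial>lborel) \<longlonglongrightarrow> 0"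
proof -
  have "h \<in> borel_measurable lebesgue"
    by (simp add: measurable_completion)
  then have "h measurable_on UNIV"
    by (simp add: measurable_on_iff_borel_measurable)
  then obtain N g where N: "negligible N" and g: "\<And>n. continuous_on UNIV (g n :: 'a \<Rightarrow> complex)"
    and lim: "\<And>x. x \<notin> N \<Longrightarrow> (\<lambda>n. g n x) \<longlonglongrightarrow> h x"
    unfolding measurable_on_def by auto
  define bump where "bump x = max 0 (min 1 (M + 1 - norm x))" for x :: 'a
  define clip where "clip z = (M / max M (cmod z)) *\<^sub>R z" for z :: complex
  define k where "k n x = bump x *\<^sub>R clip (g n x)" for n x
  have cont_clip: "continuous_on UNIV clip"
    unfolding clip_def[abs_def] using M by (intro continuous_intros) (auto simp: max_def)
  have clip_le: "cmod (clip z) \<le> M" for z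
    using M by (cases "cmod z \<le> M") (auto simp: clip_def max_def)
  have clip_id: "clip z = z" if "cmod z \<le> M" for z
    using M that by (simp add: clip_def max_def)
  have bump: "0 \<le> bump x" "bump x \<le> 1" for x by (auto simp: bump_def)
  have cont: "continuous_on UNIV (k n)" for n
    unfolding k_def[abs_def] bump_def
    by (intro continuous_intros continuous_on_compose2[OF cont_clip g]) auto
  have le: "cmod (k n x) \<le> M" for n x
    using mult_mono[OF bump(2)[of x] clip_le[of "g n x"]] bump[of x] by (simp add: k_def)
  have zero: "k n x = 0" if "M + 1 < norm x" for n x
    using that by (simp add: k_def bump_def)
  have [measurable]: "k n \<in> borel_measurable borel" for n
    using cont by (rule borel_measurable_continuous_onI)
  have "(\<lambda>n. \<integral>x. (cmod (h x - k n x))\<^sup>2 \<partial>lborel) \<longlonglongrightarrow> integral\<^sup>L lborel (\<lambda>x::'a. 0)"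
  proof (rule integral_dominated_convergence)
    show "integrable lborel (\<lambda>x::'a. indicator (cball 0 (M + 1)) x *\<^sub>R (2 * M\<^sup>2 + 2 * M\<^sup>2))"
      by (rule integrable_indicator[OF _ emeasure_bounded_finite[OF bounded_cball]]) simp
    show "AE x in lborel. norm ((cmod (h x - k n x))\<^sup>2) \<le> indicator (cball 0 (M + 1)) x *\<^sub>R (2 * M\<^sup>2 + 2 * M\<^sup>2)" for n
    proof (rule AE_I2)
      fix x
      have "(cmod (h x - k n x))\<^sup>2 \<le> 2 * M\<^sup>2 + 2 * M\<^sup>2"
        using norm_diff_square_le[of "h x" "k n x"] power_mono[OF bnd[of x], of 2] power_mono[OF le[of n x], of 2] by simp
      then show "norm ((cmod (h x - k n x))\<^sup>2) \<le> indicator (cball 0 (M + 1)) x *\<^sub>R (2 * M\<^sup>2 + 2 * M\<^sup>2)"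
        using supp[of x] zero[of x n] by (auto simp: indicator_def)
    qed
    have "AE x in lborel. x \<notin> N"
      using N by (auto simp: negligible_iff_null_sets null_sets_completion_iff2 eventually_ae_filter)
    then show "AE x in lborel. (\<lambda>n. (cmod (h x - k n x))\<^sup>2) \<longlonglongrightarrow> 0"
    proof eventually_elim
      case (elim x)
      have hx: "bump x *\<^sub>R h x = h x"
        using supp[of x] by (cases "M < norm x") (auto simp: bump_def)
      have "isCont clip (h x)"
        using cont_clip by (simp add: continuous_on_eq_continuous_at)
      then have "(\<lambda>n. clip (g n x)) \<longlonglongrightarrow> clip (h x)"
        using lim[OF elim] by (rule isCont_tendsto_compose)
      then have "(\<lambda>n. (cmod (h x - k n x))\<^sup>2) \<longlonglongrightarrow> (cmod (h x - bump x *\<^sub>R clip (h x)))\<^sup>2"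
        unfolding k_def by (intro tendsto_intros)
      then show ?case
        by (simp add: clip_id[OF bnd] hx)
    qed
  qed auto
  then have "(\<lambda>n. \<integral>x. (cmod (h x - k n x))\<^sup>2 \<partial>lborel) \<longlonglongrightarrow> 0" by simp
  with cont le zero show ?thesis by (rule that)
qed

lemma integrable_bounded_support:
  fixes k :: "'a::euclidean_space \<Rightarrow> 'b::{banach, second_countable_topology}"
  assumes [measurable]: "k \<in> borel_measurable borel" and "\<And>x. norm (k x) \<le> B" and "\<And>x. R < norm x \<Longrightarrow> k x = 0"
  shows "integrable lborel k"
proof (rule Bochner_Integration.integrable_bound)
  show "integrable lborel (\<lambda>x::'a. indicator (cball 0 R) x *\<^sub>R B)"
    by (rule integrable_indicator[OF _ emeasure_bounded_finite[OF bounded_cball]]) simp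
  show "AE x in lborel. norm (k x) \<le> norm (indicator (cball 0 R) x *\<^sub>R B)"
    using assms(2,3) by (intro AE_I2) (auto simp: indicator_def not_le intro: order_trans[OF _ abs_ge_self])
qed measurable

lemma L2_dense_continuous:
  fixes h :: "'a::euclidean_space \<Rightarrow> complex"
  assumes [measurable]: "h \<in> borel_measurable borel" and h2: "integrable lborel (\<lambda>x. (cmod (h x))\<^sup>2)"
    and \<delta>: "0 < \<delta>"
  obtains k B where "continuous_on UNIV k" "\<And>x. cmod (k x) \<le> B" "integrable lborel k"
    "integrable lborel (\<lambda>x. (cmod (k x))\<^sup>2)" "(\<integral>x. (cmod (h x - k x))\<^sup>2 \<partial>lborel) < \<delta>"
proof -
  let ?h = "\<lambda>n x. if norm x \<le> real n \<and> cmod (h x) \<le> real n then h x else 0"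
  \<comment> \<open>Truncation and continuous approximation each cost less than
    \<open>\<delta> / 4\<close>; the inequality \<open>norm_diff_square_le\<close> doubles both
    errors, and the total stays below \<delta>.\<close>
  have "eventually (\<lambda>n. (\<integral>x. (cmod (h x - ?h n x))\<^sup>2 \<partial>lborel) < \<delta> / 4) sequentially"
    using L2_dense_bounded[OF assms(1) h2] \<delta> by (intro order_tendstoD) auto
  moreover have "eventually (\<lambda>n. 0 < n) sequentially" by (rule eventually_gt_at_top)
  ultimately obtain n where n: "(\<integral>x. (cmod (h x - ?h n x))\<^sup>2 \<partial>lborel) < \<delta> / 4" "0 < n"
    using eventually_happens'[OF sequentially_bot] eventually_conj by blast
  obtain k where k: "\<And>m. continuous_on UNIV (k m)" "\<And>m x. cmod (k m x) \<le> real n"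
    "\<And>m x. real n + 1 < norm x \<Longrightarrow> k m x = 0" "(\<lambda>m. \<integral>x. (cmod (?h n x - k m x))\<^sup>2 \<partial>lborel) \<longlonglongrightarrow> 0"
    by (rule bounded_approx_continuous[of "?h n" "real n"]) (use n(2) in auto)
  have "eventually (\<lambda>m. (\<integral>x. (cmod (?h n x - k m x))\<^sup>2 \<partial>lborel) < \<delta> / 4) sequentially"
    using k(4) \<delta> by (intro order_tendstoD) auto
  then obtain m where m: "(\<integral>x. (cmod (?h n x - k m x))\<^sup>2 \<partial>lborel) < \<delta> / 4"
    using eventually_happens'[OF sequentially_bot] by blast
  have [measurable]: "k m \<in> borel_measurable borel"
    using k(1) by (rule borel_measurable_continuous_onI)
  have int: "integrable lborel (\<lambda>x. (cmod (h x - ?h n x))\<^sup>2)"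
    using h2 by (rule Bochner_Integration.integrable_bound) auto
  have sq: "(cmod z)\<^sup>2 \<le> (real n)\<^sup>2" if "cmod z \<le> real n" for z
    using that by (intro power_mono) auto
  have int': "integrable lborel (\<lambda>x. (cmod (?h n x - k m x))\<^sup>2)"
  proof (rule integrable_bounded_support[where R = "real n + 1" and B = "4 * (real n)\<^sup>2"])
    show "norm ((cmod (?h n x - k m x))\<^sup>2) \<le> 4 * (real n)\<^sup>2" for x
    proof -
      have "(cmod (?h n x))\<^sup>2 \<le> (real n)\<^sup>2" by (rule sq) simp
      then have "(cmod (?h n x - k m x))\<^sup>2 \<le> 4 * (real n)\<^sup>2"
        using norm_diff_square_le[of "?h n x" "k m x"] sq[OF k(2)[of m x]] by linarith
      then show ?thesis by (simp only: real_norm_def abs_power2)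
    qed
  qed (use k(3) in auto)
  have "(\<integral>x. (cmod (h x - k m x))\<^sup>2 \<partial>lborel) \<le> (\<integral>x. 2 * (cmod (h x - ?h n x))\<^sup>2 + 2 * (cmod (?h n x - k m x))\<^sup>2 \<partial>lborel)"
  proof (rule integral_mono_AE')
    show "integrable lborel (\<lambda>x. 2 * (cmod (h x - ?h n x))\<^sup>2 + 2 * (cmod (?h n x - k m x))\<^sup>2)"
      using int int' by simp
    show "AE x in lborel. (cmod (h x - k m x))\<^sup>2 \<le> 2 * (cmod (h x - ?h n x))\<^sup>2 + 2 * (cmod (?h n x - k m x))\<^sup>2"
    proof (rule AE_I2)
      fix x
      show "(cmod (h x - k m x))\<^sup>2 \<le> 2 * (cmod (h x - ?h n x))\<^sup>2 + 2 * (cmod (?h n x - k m x))\<^sup>2"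
        using norm_diff_square_le[of "h x - ?h n x" "k m x - ?h n x"] by (simp add: norm_minus_commute)
    qed
  qed simp
  also have "\<dots> < \<delta>"
    using int int' n(1) m by simp
  finally have "(\<integral>x. (cmod (h x - k m x))\<^sup>2 \<partial>lborel) < \<delta>" .
  moreover have "integrable lborel (k m)"
    using k by (intro integrable_bounded_support[where B = "real n" and R = "real n + 1"]) auto
  moreover have "integrable lborel (\<lambda>x. (cmod (k m x))\<^sup>2)"
    using k sq by (intro integrable_bounded_support[where B = "(real n)\<^sup>2" and R = "real n + 1"]) auto
  ultimately show ?thesis
    using that[of "k m" "real n"] k by blast
qed

theorem plancherel:
  fixes h :: "'a::euclidean_space \<Rightarrow> complex"
  assumes h: "integrable lborel h" and h2: "integrable lborel (\<lambda>x. (cmod (h x))\<^sup>2)"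
  shows "(\<integral>w. (cmod (fourier h w))\<^sup>2 \<partial>lborel) = (2 * pi) ^ DIM('a) * (\<integral>x. (cmod (h x))\<^sup>2 \<partial>lborel)"
proof -
  let ?c = "(2 * pi) ^ DIM('a)" and ?I = "\<lambda>h::'a \<Rightarrow> complex. \<integral>x. (cmod (h x))\<^sup>2 \<partial>lborel"
  have [measurable]: "h \<in> borel_measurable borel"
    using h by (auto dest: borel_measurable_integrable)
  have polar: "(cmod (x - y))\<^sup>2 = (cmod x)\<^sup>2 - 2 * Re (x * cnj y) + (cmod y)\<^sup>2" for x y
    unfolding cmod_power2 by (simp add: power2_eq_square algebra_simps)
  have diff: "?I (\<lambda>x. u x - v x) = ?I u - 2 * Re (\<integral>x. u x * cnj (v x) \<partial>lborel) + ?I v"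
    if "u \<in> borel_measurable borel" "v \<in> borel_measurable borel" "integrable lborel (\<lambda>x. (cmod (u x))\<^sup>2)" "integrable lborel (\<lambda>x. (cmod (v x))\<^sup>2)" for u v
  proof -
    have "integrable lborel (\<lambda>x. u x * cnj (v x))"
      using that by (intro integrable_mult_cnj) auto
    note int = this
    have "integrable lborel (\<lambda>x. 2 * Re (u x * cnj (v x)))"
      by (intro integrable_mult_right integrable_Re int)
    moreover have "(\<integral>x. 2 * Re (u x * cnj (v x)) \<partial>lborel) = 2 * Re (\<integral>x. u x * cnj (v x) \<partial>lborel)"
      unfolding integral_mult_right_zero integral_Re[OF int] by (rule refl)
    ultimately show ?thesis
      using that unfolding polar
      by (simp only: Bochner_Integration.integral_add Bochner_Integration.integral_diff Bochner_Integration.integrable_diff)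
  qed
  have "?c * ?I h \<le> ?I (fourier h) + e" if e: "0 < e" for e
  proof -
    \<comment> \<open>The tolerance is divided by \<open>?c\<close> because the distance from
      \<open>h\<close> to \<open>k\<close> comes back multiplied by \<open>?c\<close>.\<close>
    obtain k B where k: "continuous_on UNIV k" "\<And>x. cmod (k x) \<le> B" "integrable lborel k"
      "integrable lborel (\<lambda>x. (cmod (k x))\<^sup>2)" "?I (\<lambda>x. h x - k x) < e / ?c"
      by (rule L2_dense_continuous[OF _ h2, of "e / ?c"]) (use e in auto)
    have [measurable]: "k \<in> borel_measurable borel"
      using k(3) by (auto dest: borel_measurable_integrable)
    note Fh2 = integrable_fourier_square(1)[OF h h2] and Fk2 = integrable_fourier_square(1)[OF k(3,4)]
    have "0 \<le> ?I (\<lambda>w. fourier h w - fourier k w)" by simp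
    also have "\<dots> = ?I (fourier h) - 2 * Re (\<integral>w. fourier h w * cnj (fourier k w) \<partial>lborel) + ?I (fourier k)"
      by (rule diff) (use Fh2 Fk2 in auto)
    \<comment> \<open>The mixed term is exact by Parseval. The last term enters with a plus sign, so
      for \<open>k\<close> the inequality already known suffices; what results completes to the
      square of \<open>h - k\<close>.\<close>
    also have "\<dots> \<le> ?I (fourier h) - 2 * (?c * Re (\<integral>x. h x * cnj (k x) \<partial>lborel)) + ?c * ?I k"
    proof -
      have "Re (complex_of_real r * z) = r * Re z" for r z by simp
      then show ?thesis
        unfolding parseval_continuous[OF h h2 k(3,4,1,2)]
        using integrable_fourier_square(2)[OF k(3,4)] by (simp only:)
    qed
    also have "\<dots> = ?I (fourier h) - ?c * ?I h + ?c * ?I (\<lambda>x. h x - k x)"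
    proof -
      have *: "A - 2 * (c * R) + c * K = A - c * H + c * (H - 2 * R + K)" for A c R K H :: real
        by (simp add: algebra_simps)
      have "?I (\<lambda>x. h x - k x) = ?I h - 2 * Re (\<integral>x. h x * cnj (k x) \<partial>lborel) + ?I k"
        by (rule diff) (use h2 k(4) in auto)
      then show ?thesis by (simp only: *)
    qed
    finally have "?c * ?I h \<le> ?I (fourier h) + ?c * ?I (\<lambda>x. h x - k x)" by linarith
    moreover have "0 < ?c" by simp
    then have "?c * ?I (\<lambda>x. h x - k x) < e"
      using k(5) by (metis pos_less_divide_eq mult.commute)
    ultimately show ?thesis by linarith
  qed
  then have "?c * ?I h \<le> ?I (fourier h)" by (rule field_le_epsilon)
  with integrable_fourier_square(2)[OF h h2] show ?thesis by simp
qed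

subsection \<open>Limits in \<open>L\<^sup>2\<close>\<close>

text \<open>Riesz-Fischer for a family with a real index. A fast subsequence converges almost
  everywhere, and Fatou's lemma carries the Cauchy bound over to the limit for every
  \<open>R\<close>, so the rate \<open>\<rho>\<close> survives.\<close>

lemma L2_complete_at_top:
  fixes X :: "real \<Rightarrow> 'a \<Rightarrow> 'b::euclidean_space" and \<rho> :: "real \<Rightarrow> ennreal"
  assumes [measurable]: "\<And>R. X R \<in> borel_measurable M"
    and cauchy: "\<And>R S. R \<le> S \<Longrightarrow> (\<integral>\<^sup>+z. ennreal ((norm (X R z - X S z))\<^sup>2) \<partial>M) \<le> \<rho> R"
    and \<rho>: "(\<rho> \<longlongrightarrow> 0) at_top"
  obtains g where "g \<in> borel_measurable M" "\<And>R. (\<integral>\<^sup>+z. ennreal ((norm (X R z - g z))\<^sup>2) \<partial>M) \<le> \<rho> R"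
proof -
  have "\<exists>r. \<forall>R\<ge>r. \<rho> R < ennreal ((1 / 8) ^ k)" for k :: nat
    using order_tendstoD(2)[OF \<rho>, of "ennreal ((1 / 8) ^ k)"] by (simp add: eventually_at_top_linorder)
  then obtain r where r: "\<And>k R. r k \<le> R \<Longrightarrow> \<rho> R < ennreal ((1 / 8) ^ k)"
    by metis
  \<comment> \<open>Partial sums make the indices increasing; each \<open>q k\<close> also lies
    above \<open>r k\<close>, and above \<open>k\<close>, so that it eventually passes every
    \<open>R\<close>.\<close>
  define q where "q k = (\<Sum>i\<le>k. \<bar>r i\<bar> + 1)" for k :: nat
  have q_Suc: "q k \<le> q (Suc k)" for k by (simp add: q_def)
  have q_ge: "real k \<le> q k" for k
    by (induction k) (auto simp: q_def)
  have "r k \<le> q k" for k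
  proof -
    have "\<bar>r k\<bar> + 1 \<le> q k"
      unfolding q_def by (rule member_le_sum) auto
    then show ?thesis by simp
  qed
  then have small: "(\<integral>\<^sup>+z. ennreal ((norm (X (q k) z - X (q (Suc k)) z))\<^sup>2) \<partial>M) \<le> ennreal ((1 / 8) ^ k)" for k
    using cauchy[OF q_Suc[of k]] r[of k "q k"] by (meson less_imp_le order_trans)
  \<comment> \<open>Squared distances below \<open>(1 / 8) ^ k\<close> leave room for the weight
    \<open>4 ^ k\<close>: the weighted series still has finite integral, and wherever it is finite
    the increments are at most a constant times \<open>(1 / 2) ^ k\<close>.\<close>
  let ?S = "\<lambda>z. \<Sum>k. ennreal (4 ^ k) * ennreal ((norm (X (q k) z - X (q (Suc k)) z))\<^sup>2)"
  have "(\<integral>\<^sup>+z. ?S z \<partial>M) = (\<Sum>k. ennreal (4 ^ k) * (\<integral>\<^sup>+z. ennreal ((norm (X (q k) z - X (q (Suc k)) z))\<^sup>2) \<partial>M))"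
    by (subst nn_integral_suminf) (auto simp: nn_integral_cmult)
  also have "\<dots> \<le> (\<Sum>k. ennreal (4 ^ k) * ennreal ((1 / 8) ^ k))"
    by (intro suminf_le mult_left_mono small) auto
  also have "\<dots> = (\<Sum>k. ennreal ((1 / 2) ^ k))"
    by (simp add: ennreal_mult'[symmetric] power_mult_distrib[symmetric])
  also have "\<dots> < \<infinity>"
    by (subst suminf_ennreal2) (auto simp: summable_geometric)
  finally have "(\<integral>\<^sup>+z. ?S z \<partial>M) \<noteq> \<infinity>" by simp
  then have fin: "AE z in M. ?S z \<noteq> \<infinity>"
    by (intro nn_integral_PInf_AE) auto
  \<comment> \<open>Where the sequence diverges \<open>lim\<close> is unspecified, which concerns
    only a null set; measurability holds regardless.\<close>
  define g where "g z = lim (\<lambda>k. X (q k) z)" for z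
  have g[measurable]: "g \<in> borel_measurable M"
    unfolding g_def by (rule borel_measurable_lim_metric) measurable
  have conv: "AE z in M. (\<lambda>k. X (q k) z) \<longlonglongrightarrow> g z"
    using fin
  proof eventually_elim
    case (elim z)
    let ?d = "\<lambda>k. norm (X (q k) z - X (q (Suc k)) z)"
    obtain C where C: "?S z = ennreal C" "0 \<le> C"
      using elim by (cases "?S z") auto
    have "?d k \<le> sqrt C * (1 / 2) ^ k" for k
    proof -
      have "ennreal (4 ^ k) * ennreal ((?d k)\<^sup>2) \<le> ?S z"
        using sum_le_suminf[of "\<lambda>k. ennreal (4 ^ k) * ennreal ((?d k)\<^sup>2)" "{k}"] by simp
      then have "4 ^ k * (?d k)\<^sup>2 \<le> C"
        using C by (simp add: ennreal_mult'[symmetric])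
      moreover have "(4::real) ^ k = (2 ^ k)\<^sup>2"
        unfolding power2_eq_square power_mult_distrib[symmetric] by simp
      ultimately have "(2 ^ k * ?d k)\<^sup>2 \<le> C"
        by (simp only: power_mult_distrib)
      then have "2 ^ k * ?d k \<le> sqrt C"
        by (rule real_le_rsqrt)
      then show ?thesis
        by (simp add: power_one_over pos_le_divide_eq mult.commute)
    qed
    note le = this
    have "summable ?d"
    proof (rule summable_comparison_test')
      show "summable (\<lambda>k. sqrt C * (1 / 2) ^ k)"
        by (intro summable_mult summable_geometric) simp
      show "norm (?d k) \<le> sqrt C * (1 / 2) ^ k" if "0 \<le> k" for k
        using le[of k] by (simp only: real_norm_def abs_norm_cancel)
    qed
    moreover have "norm (X (q (Suc k)) z - X (q k) z) = ?d k" for k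
      by (rule norm_minus_commute)
    ultimately have "summable (\<lambda>k. X (q (Suc k)) z - X (q k) z)"
      by (simp only: summable_norm_cancel)
    then have "(\<lambda>n. (\<Sum>k<n. X (q (Suc k)) z - X (q k) z) + X (q 0) z) \<longlonglongrightarrow>
        (\<Sum>k. X (q (Suc k)) z - X (q k) z) + X (q 0) z"
      by (intro tendsto_add tendsto_const summable_LIMSEQ)
    then have "(\<lambda>n. X (q n) z) \<longlonglongrightarrow> (\<Sum>k. X (q (Suc k)) z - X (q k) z) + X (q 0) z"
      by (simp only: sum_lessThan_telescope[of "\<lambda>n. X (q n) z"] diff_add_cancel)
    with limI[OF this] show "(\<lambda>k. X (q k) z) \<longlonglongrightarrow> g z"
      by (simp only: g_def)
  qed
  have "(\<integral>\<^sup>+z. ennreal ((norm (X R z - g z))\<^sup>2) \<partial>M) \<le> \<rho> R" for R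
  proof -
    have "(\<integral>\<^sup>+z. ennreal ((norm (X R z - g z))\<^sup>2) \<partial>M) =
        (\<integral>\<^sup>+z. liminf (\<lambda>k. ennreal ((norm (X R z - X (q k) z))\<^sup>2)) \<partial>M)"
    proof (rule nn_integral_cong_AE, use conv in eventually_elim)
      case (elim z)
      have "(\<lambda>k. ennreal ((norm (X R z - X (q k) z))\<^sup>2)) \<longlonglongrightarrow> ennreal ((norm (X R z - g z))\<^sup>2)"
        by (intro tendsto_intros elim)
      then show ?case
        using lim_imp_Liminf[OF sequentially_bot] by fastforce
    qed
    also have "\<dots> \<le> liminf (\<lambda>k. \<integral>\<^sup>+z. ennreal ((norm (X R z - X (q k) z))\<^sup>2) \<partial>M)"
      by (rule nn_integral_liminf) measurable
    also have "\<dots> \<le> \<rho> R"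
    proof (rule Liminf_le[OF sequentially_bot])
      obtain n where n: "R \<le> real n" using real_arch_simple by blast
      show "eventually (\<lambda>k. (\<integral>\<^sup>+z. ennreal ((norm (X R z - X (q k) z))\<^sup>2) \<partial>M) \<le> \<rho> R) sequentially"
        using eventually_ge_at_top[of n]
      proof eventually_elim
        case (elim k)
        then have "R \<le> q k" using n q_ge[of k] by linarith
        then show ?case by (rule cauchy)
      qed
    qed
    finally show ?thesis .
  qed
  with g show ?thesis by (rule that)
qed

text \<open>The triangle inequality followed by Young's inequality with weight
  \<open>sqrt \<eta>\<close>. The coefficient of the main term can be brought arbitrarily close to
  1, so it can replace the L2 triangle inequality for integrals of squares in
  \<open>ennreal\<close>.\<close>

lemma norm_square_le_weighted:
  fixes x y :: "'a::real_inner"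
  assumes "0 < \<eta>"
  shows "(norm x)\<^sup>2 \<le> (1 + \<eta>) * (norm y)\<^sup>2 + (1 + 1 / \<eta>) * (norm (y - x))\<^sup>2"
proof -
  have "norm x \<le> norm y + norm (y - x)"
    by (metis norm_triangle_sub norm_minus_commute)
  then have "(norm x)\<^sup>2 \<le> (norm y + norm (y - x))\<^sup>2"
    by (rule power_mono) simp
  also have "\<dots> = (norm y)\<^sup>2 + 2 * (sqrt \<eta> * norm y) * (norm (y - x) / sqrt \<eta>) + (norm (y - x))\<^sup>2"
    using assms by (simp add: power2_sum)
  also have "\<dots> \<le> (norm y)\<^sup>2 + ((sqrt \<eta> * norm y)\<^sup>2 + (norm (y - x) / sqrt \<eta>)\<^sup>2) + (norm (y - x))\<^sup>2"
    using sum_squares_bound[of "sqrt \<eta> * norm y" "norm (y - x) / sqrt \<eta>"] by linarith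
  also have "\<dots> = (1 + \<eta>) * (norm y)\<^sup>2 + (1 + 1 / \<eta>) * (norm (y - x))\<^sup>2"
    using assms by (simp add: power_mult_distrib power_divide algebra_simps)
  finally show ?thesis .
qed

lemma nn_integral_square_le_weighted:
  fixes g h :: "'a \<Rightarrow> 'b::euclidean_space"
  assumes [measurable]: "g \<in> borel_measurable M" "h \<in> borel_measurable M" and \<eta>: "0 < \<eta>"
  shows "(\<integral>\<^sup>+z. ennreal ((norm (g z))\<^sup>2) \<partial>M) \<le> ennreal (1 + \<eta>) * (\<integral>\<^sup>+z. ennreal ((norm (h z))\<^sup>2) \<partial>M) +
    ennreal (1 + 1 / \<eta>) * (\<integral>\<^sup>+z. ennreal ((norm (h z - g z))\<^sup>2) \<partial>M)"
proof -
  have "(\<integral>\<^sup>+z. ennreal ((norm (g z))\<^sup>2) \<partial>M) \<le>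
      (\<integral>\<^sup>+z. ennreal (1 + \<eta>) * ennreal ((norm (h z))\<^sup>2) + ennreal (1 + 1 / \<eta>) * ennreal ((norm (h z - g z))\<^sup>2) \<partial>M)"
  proof (rule nn_integral_mono)
    fix z
    show "ennreal ((norm (g z))\<^sup>2) \<le> ennreal (1 + \<eta>) * ennreal ((norm (h z))\<^sup>2) + ennreal (1 + 1 / \<eta>) * ennreal ((norm (h z - g z))\<^sup>2)"
      using ennreal_leI[OF norm_square_le_weighted[OF \<eta>, of "g z" "h z"]] \<eta>
      by (simp add: ennreal_plus ennreal_mult)
  qed
  also have "\<dots> = ennreal (1 + \<eta>) * (\<integral>\<^sup>+z. ennreal ((norm (h z))\<^sup>2) \<partial>M) +
    ennreal (1 + 1 / \<eta>) * (\<integral>\<^sup>+z. ennreal ((norm (h z - g z))\<^sup>2) \<partial>M)"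
    by (simp add: nn_integral_add nn_integral_cmult)
  finally show ?thesis .
qed

lemma ennreal_le_if_le_mult:
  fixes a b :: ennreal
  assumes "\<And>\<eta>::real. 0 < \<eta> \<Longrightarrow> a \<le> ennreal (1 + \<eta>) * b"
  shows "a \<le> b"
proof (rule tendsto_lowerbound)
  show "((\<lambda>\<eta>. ennreal (1 + \<eta>) * b) \<longlongrightarrow> b) (at_right 0)"
  proof (cases "b = \<infinity>")
    case True
    have "ennreal (1 + \<eta>) * b = b" if "0 < \<eta>" for \<eta>
      using that True by (simp add: ennreal_mult_top)
    then have "eventually (\<lambda>\<eta>. ennreal (1 + \<eta>) * b = b) (at_right 0)"
      by (rule eventually_mono[OF eventually_at_right_less])
    then show ?thesis
      by (rule tendsto_eventually)
  next
    case False
    have "((\<lambda>\<eta>. ennreal (1 + \<eta>) * b) \<longlongrightarrow> ennreal (1 + 0) * b) (at_right 0)"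
      using False by (intro tendsto_intros tendsto_mult_ennreal) auto
    then show ?thesis by simp
  qed
  show "eventually (\<lambda>\<eta>. a \<le> ennreal (1 + \<eta>) * b) (at_right 0)"
    using eventually_at_right_less by (rule eventually_mono) (rule assms)
qed simp

text \<open>For fixed \<eta> first \<open>R\<close> tends to infinity, which removes the error term
  in spite of its large coefficient; only then does \<eta> tend to 0. The weighted inequality is
  used in both directions.\<close>

lemma L2_norm_limit:
  fixes X :: "real \<Rightarrow> 'a \<Rightarrow> 'b::euclidean_space"
  assumes [measurable]: "\<And>R. X R \<in> borel_measurable M" "g \<in> borel_measurable M"
    and lim: "((\<lambda>R. \<integral>\<^sup>+z. ennreal ((norm (X R z - g z))\<^sup>2) \<partial>M) \<longlongrightarrow> 0) at_top"
    and A: "((\<lambda>R. \<integral>\<^sup>+z. ennreal ((norm (X R z))\<^sup>2) \<partial>M) \<longlongrightarrow> A) at_top"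
  shows "(\<integral>\<^sup>+z. ennreal ((norm (g z))\<^sup>2) \<partial>M) = A"
proof (rule antisym; rule ennreal_le_if_le_mult)
  fix \<eta> :: real assume \<eta>: "0 < \<eta>"
  let ?G = "\<integral>\<^sup>+z. ennreal ((norm (g z))\<^sup>2) \<partial>M"
  have 0: "((\<lambda>R. ennreal (1 + 1 / \<eta>) * (\<integral>\<^sup>+z. ennreal ((norm (X R z - g z))\<^sup>2) \<partial>M)) \<longlongrightarrow> 0) at_top"
    using tendsto_mult_ennreal[OF tendsto_const[of "ennreal (1 + 1 / \<eta>)"] lim] by simp
  have 1: "((\<lambda>R. ennreal (1 + \<eta>) * (\<integral>\<^sup>+z. ennreal ((norm (X R z))\<^sup>2) \<partial>M)) \<longlongrightarrow> ennreal (1 + \<eta>) * A) at_top"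
    using \<eta> by (intro tendsto_mult_ennreal tendsto_const A) auto
  show "?G \<le> ennreal (1 + \<eta>) * A"
  proof (rule tendsto_lowerbound)
    show "((\<lambda>R. ennreal (1 + \<eta>) * (\<integral>\<^sup>+z. ennreal ((norm (X R z))\<^sup>2) \<partial>M) +
        ennreal (1 + 1 / \<eta>) * (\<integral>\<^sup>+z. ennreal ((norm (X R z - g z))\<^sup>2) \<partial>M)) \<longlongrightarrow> ennreal (1 + \<eta>) * A) at_top"
      using tendsto_add[OF 1 0] by simp
  qed (auto intro!: always_eventually nn_integral_square_le_weighted \<eta>)
  have "A \<le> ennreal (1 + \<eta>) * ?G + 0"
  proof (rule tendsto_le[OF _ _ A])
    show "((\<lambda>R. ennreal (1 + \<eta>) * ?G +
        ennreal (1 + 1 / \<eta>) * (\<integral>\<^sup>+z. ennreal ((norm (X R z - g z))\<^sup>2) \<partial>M)) \<longlongrightarrow> ennreal (1 + \<eta>) * ?G + 0) at_top"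
      by (intro tendsto_add tendsto_const 0)
    show "eventually (\<lambda>R. (\<integral>\<^sup>+z. ennreal ((norm (X R z))\<^sup>2) \<partial>M) \<le> ennreal (1 + \<eta>) * ?G +
        ennreal (1 + 1 / \<eta>) * (\<integral>\<^sup>+z. ennreal ((norm (X R z - g z))\<^sup>2) \<partial>M)) at_top"
      using nn_integral_square_le_weighted[of "X _" M g, OF _ _ \<eta>]
      by (simp add: norm_minus_commute)
  qed simp
  then show "A \<le> ennreal (1 + \<eta>) * ?G" by simp
qed

lemma integral_inner_polar:
  fixes g h :: "'a \<Rightarrow> 'b::euclidean_space"
  assumes [measurable]: "g \<in> borel_measurable M" "h \<in> borel_measurable M"
    and g2: "integrable M (\<lambda>z. (norm (g z))\<^sup>2)" and h2: "integrable M (\<lambda>z. (norm (h z))\<^sup>2)"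
  shows "integrable M (\<lambda>z. (norm (g z + h z))\<^sup>2)"
    and "(\<integral>z. g z \<bullet> h z \<partial>M) = ((\<integral>z. (norm (g z + h z))\<^sup>2 \<partial>M) - (\<integral>z. (norm (g z))\<^sup>2 \<partial>M) - (\<integral>z. (norm (h z))\<^sup>2 \<partial>M)) / 2"
proof -
  show int: "integrable M (\<lambda>z. (norm (g z + h z))\<^sup>2)"
  proof (rule Bochner_Integration.integrable_bound)
    show "integrable M (\<lambda>z. 2 * (norm (g z))\<^sup>2 + 2 * (norm (h z))\<^sup>2)"
      using g2 h2 by simp
    show "AE z in M. norm ((norm (g z + h z))\<^sup>2) \<le> norm (2 * (norm (g z))\<^sup>2 + 2 * (norm (h z))\<^sup>2)"
      using norm_diff_square_le[of "g _" "- h _"] by (intro AE_I2) simp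
  qed measurable
  have "g z \<bullet> h z = ((norm (g z + h z))\<^sup>2 - (norm (g z))\<^sup>2 - (norm (h z))\<^sup>2) / 2" for z
    by (simp add: power2_norm_eq_inner inner_simps inner_commute)
  then show "(\<integral>z. g z \<bullet> h z \<partial>M) = ((\<integral>z. (norm (g z + h z))\<^sup>2 \<partial>M) - (\<integral>z. (norm (g z))\<^sup>2 \<partial>M) - (\<integral>z. (norm (h z))\<^sup>2 \<partial>M)) / 2"
    using int g2 h2 by (simp only: integral_divide_zero Bochner_Integration.integral_diff Bochner_Integration.integrable_diff)
qed

subsection \<open>Chirp and slice operators\<close>

lemma borel_measurable_fst [measurable (raw)]:
  fixes f :: "'a \<Rightarrow> 'b::second_countable_topology \<times> 'c::second_countable_topology"
  assumes "f \<in> borel_measurable M" shows "(\<lambda>x. fst (f x)) \<in> borel_measurable M"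
  using measurable_compose[OF assms borel_measurable_continuous_onI[OF continuous_on_fst[OF continuous_on_id]]] by simp

lemma borel_measurable_snd [measurable (raw)]:
  fixes f :: "'a \<Rightarrow> 'b::second_countable_topology \<times> 'c::second_countable_topology"
  assumes "f \<in> borel_measurable M" shows "(\<lambda>x. snd (f x)) \<in> borel_measurable M"
  using measurable_compose[OF assms borel_measurable_continuous_onI[OF continuous_on_snd[OF continuous_on_id]]] by simp

section \<open>Two-sided rotations by phases\<close>

definition rot :: "real \<Rightarrow> real \<Rightarrow> cl31 \<Rightarrow> cl31" where
  "rot \<theta> \<phi> v = cl_mult (cl_mult (cl_exp e_t \<theta>) v) (cl_exp i3 \<phi>)"

lemma linear_rot: "linear (rot \<theta> \<phi>)"
  using bilinear_cl_mult
  by (intro linearI) (simp_all add: rot_def bilinear_ladd bilinear_radd bilinear_lmul bilinear_rmul)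

lemma cl_coord_rot: "s * s = 1 \<Longrightarrow> cl_coord q s (rot \<theta> \<phi> v) = cis \<theta> * cis (s * \<phi>) * cl_coord q s v"
  unfolding rot_def by (rule cl_coord_sandwich)

text \<open>In each coordinate the rotation is multiplication by unimodular numbers, and by
  \<open>sum_cl_coord\<close> the coordinates determine the norm.\<close>

lemma norm_rot: "norm (rot \<theta> \<phi> v) = norm v"
proof -
  have "8 * (norm (rot \<theta> \<phi> v))\<^sup>2 = 8 * (norm v)\<^sup>2"
    unfolding sum_cl_coord[symmetric] by (simp add: cl_coord_rot norm_mult)
  then show ?thesis by (simp add: power2_eq_iff_nonneg)
qed

lemma borel_measurable_linear:
  fixes f :: "'a::euclidean_space \<Rightarrow> 'b::euclidean_space"
  assumes "linear f" shows "f \<in> borel_measurable borel"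
  using assms by (intro borel_measurable_continuous_onI linear_continuous_on) (simp add: linear_conv_bounded_linear)

lemma borel_measurable_cl_coord [measurable]: "cl_coord q s \<in> borel_measurable borel"
  by (rule borel_measurable_linear[OF linear_cl_coord])

lemma borel_measurable_rot [measurable (raw)]:
  assumes [measurable]: "\<theta> \<in> borel_measurable M" "\<phi> \<in> borel_measurable M" "h \<in> borel_measurable M"
  shows "(\<lambda>z. rot (\<theta> z) (\<phi> z) (h z)) \<in> borel_measurable M"
proof -
  have [measurable]: "left_et \<in> borel_measurable borel" "right_i3 \<in> borel_measurable borel"
    by (intro borel_measurable_linear linear_left_et linear_right_i3)+
  show ?thesis
    unfolding rot_def cl_exp_sandwich by measurable
qed

lemma nn_integral_cl_coord:
  assumes [measurable]: "h \<in> borel_measurable M"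
  shows "8 * (\<integral>\<^sup>+z. ennreal ((norm (h z))\<^sup>2) \<partial>M) =
    (\<Sum>s\<in>{1, - 1}. \<Sum>q\<in>Basis. \<integral>\<^sup>+z. ennreal ((cmod (cl_coord q s (h z)))\<^sup>2) \<partial>M)"
proof -
  have "8 * (\<integral>\<^sup>+z. ennreal ((norm (h z))\<^sup>2) \<partial>M) = (\<integral>\<^sup>+z. ennreal (8 * (norm (h z))\<^sup>2) \<partial>M)"
    by (simp add: nn_integral_cmult ennreal_mult)
  also have "\<dots> = (\<integral>\<^sup>+z. (\<Sum>s\<in>{1, - 1}. \<Sum>q\<in>Basis. ennreal ((cmod (cl_coord q s (h z)))\<^sup>2)) \<partial>M)"
    unfolding sum_cl_coord[symmetric] by (simp only: sum_ennreal sum_nonneg zero_le_power2)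
  also have "\<dots> = (\<Sum>s\<in>{1, - 1}. \<Sum>q\<in>Basis. \<integral>\<^sup>+z. ennreal ((cmod (cl_coord q s (h z)))\<^sup>2) \<partial>M)"
    by (simp add: nn_integral_sum nn_integral_add del: sum_ennreal)
  finally show ?thesis .
qed

lemma cl_coord_integral:
  assumes "integrable M h"
  shows "cl_coord q s (\<integral>z. h z \<partial>M) = (\<integral>z. cl_coord q s (h z) \<partial>M)"
  using linear_cl_coord[of q s] assms by (simp add: integral_bounded_linear linear_conv_bounded_linear)

lemma integrable_cl_coord:
  assumes "integrable M h" shows "integrable M (\<lambda>z. cl_coord q s (h z))"
  using linear_cl_coord[of q s] assms by (simp add: integrable_bounded_linear linear_conv_bounded_linear)

lemma integrable_cl_coord_square:
  assumes [measurable]: "h \<in> borel_measurable M" and h2: "integrable M (\<lambda>z. (norm (h z))\<^sup>2)"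
    and "s \<in> {1, - 1}" "q \<in> Basis"
  shows "integrable M (\<lambda>z. (cmod (cl_coord q s (h z)))\<^sup>2)"
proof (rule Bochner_Integration.integrable_bound)
  show "integrable M (\<lambda>z. 8 * (norm (h z))\<^sup>2)" using h2 by simp
  have "(cmod (cl_coord q s v))\<^sup>2 \<le> 8 * (norm v)\<^sup>2" for v
  proof -
    have "(cmod (cl_coord q s v))\<^sup>2 \<le> (\<Sum>q\<in>Basis. (cmod (cl_coord q s v))\<^sup>2)"
      using assms(4) by (intro member_le_sum[of q Basis "\<lambda>q. (cmod (cl_coord q s v))\<^sup>2"]) auto
    also have "\<dots> \<le> (\<Sum>s\<in>{1, - 1}. \<Sum>q\<in>Basis. (cmod (cl_coord q s v))\<^sup>2)"
      using assms(3) by (intro member_le_sum[of s "{1, - 1}" "\<lambda>s. \<Sum>q\<in>Basis. (cmod (cl_coord q s v))\<^sup>2"] sum_nonneg) auto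
    finally show ?thesis unfolding sum_cl_coord .
  qed
  then show "AE z in M. norm ((cmod (cl_coord q s (h z)))\<^sup>2) \<le> norm (8 * (norm (h z))\<^sup>2)"
    by simp
qed measurable

lemma integrable_rot:
  assumes [measurable]: "\<theta> \<in> borel_measurable M" "\<phi> \<in> borel_measurable M" and h: "integrable M h"
  shows "integrable M (\<lambda>z. rot (\<theta> z) (\<phi> z) (h z))"
proof (rule Bochner_Integration.integrable_bound[OF h])
  have [measurable]: "h \<in> borel_measurable M" using h by auto
  show "(\<lambda>z. rot (\<theta> z) (\<phi> z) (h z)) \<in> borel_measurable M" by measurable
qed (simp add: norm_rot)

text \<open>On a set of finite measure L2 lies in L1, because a norm is at most 1 plus its square;
  the constant 1 is charged on the ball only.\<close>

lemma integrable_L2_bounded_support: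
  fixes h :: "'a::euclidean_space \<Rightarrow> 'b::euclidean_space"
  assumes [measurable]: "h \<in> borel_measurable borel" and h2: "integrable lborel (\<lambda>z. (norm (h z))\<^sup>2)"
    and supp: "\<And>z. R < norm z \<Longrightarrow> h z = 0"
  shows "integrable lborel h"
proof (rule Bochner_Integration.integrable_bound)
  have "integrable lborel (\<lambda>z::'a. indicator (cball 0 R) z *\<^sub>R (1::real))"
    by (rule integrable_indicator[OF _ emeasure_bounded_finite[OF bounded_cball]]) simp
  then show "integrable lborel (\<lambda>z. indicator (cball 0 R) z *\<^sub>R (1::real) + (norm (h z))\<^sup>2)"
    using h2 by (rule Bochner_Integration.integrable_add)
  have le: "norm v \<le> 1 + (norm v)\<^sup>2" for v :: 'b
    using sum_squares_bound[of "norm v" 1] zero_le_power2[of "norm v"] unfolding power_one mult_1_right by linarith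
  show "AE z in lborel. norm (h z) \<le> norm (indicator (cball 0 R) z *\<^sub>R (1::real) + (norm (h z))\<^sup>2)"
  proof (rule AE_I2)
    fix z
    show "norm (h z) \<le> norm (indicator (cball 0 R) z *\<^sub>R (1::real) + (norm (h z))\<^sup>2)"
      using le[of "h z"] supp[of z] by (cases "R < norm z") (auto simp: indicator_def)
  qed
qed measurable

section \<open>Plancherel and changes of variables for extended integrals\<close>

lemma nn_plancherel:
  fixes h :: "'a::euclidean_space \<Rightarrow> complex"
  assumes "integrable lborel h" "integrable lborel (\<lambda>x. (cmod (h x))\<^sup>2)"
  shows "(\<integral>\<^sup>+w. ennreal ((cmod (fourier h w))\<^sup>2) \<partial>lborel) =
    ennreal ((2 * pi) ^ DIM('a)) * (\<integral>\<^sup>+x. ennreal ((cmod (h x))\<^sup>2) \<partial>lborel)"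
  by (simp only: nn_integral_eq_integral assms integrable_fourier_square plancherel ennreal_mult' zero_le_power2 AE_I2
    zero_le_power mult_nonneg_nonneg pi_ge_zero zero_le_numeral)

lemma nn_integral_dilate:
  fixes f :: "'a::euclidean_space \<Rightarrow> ennreal"
  assumes [measurable]: "f \<in> borel_measurable borel" and c: "c \<noteq> 0"
  shows "(\<integral>\<^sup>+x. f x \<partial>lborel) = ennreal (\<bar>c\<bar> ^ DIM('a)) * (\<integral>\<^sup>+x. f (c *\<^sub>R x) \<partial>lborel)"
  by (subst lborel_affine[OF c, of 0]) (simp add: nn_integral_density nn_integral_distr nn_integral_cmult)

lemma nn_integral_lborel_pair:
  fixes f :: "'a::euclidean_space \<times> 'b::euclidean_space \<Rightarrow> ennreal"
  assumes "f \<in> borel_measurable borel"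
  shows "(\<integral>\<^sup>+z. f z \<partial>lborel) = (\<integral>\<^sup>+x. \<integral>\<^sup>+t. f (t, x) \<partial>lborel \<partial>lborel)"
  using lborel_pair.nn_integral_snd[of "case_prod (curry f)"] assms by (simp add: lborel_prod)

lemma nn_integral_dilate_snd:
  fixes f :: "'a::euclidean_space \<times> 'b::euclidean_space \<Rightarrow> ennreal"
  assumes [measurable]: "f \<in> borel_measurable borel" and c: "c \<noteq> 0"
  shows "(\<integral>\<^sup>+z. f z \<partial>lborel) = ennreal (\<bar>c\<bar> ^ DIM('b)) * (\<integral>\<^sup>+z. f (fst z, c *\<^sub>R snd z) \<partial>lborel)"
  using c by (simp add: nn_integral_lborel_pair nn_integral_dilate[of "\<lambda>x. \<integral>\<^sup>+t. f (t, x) \<partial>lborel"])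

text \<open>The transform for \<open>b \<noteq> 0\<close> without its constant: \<alpha>, \<beta>,
  \<kappa> will be \<open>a / (2 * b)\<close>, \<open>d / (2 * b)\<close>,
  \<open>1 / b\<close>.\<close>

definition chirp_op :: "real \<Rightarrow> real \<Rightarrow> real \<Rightarrow> (stvec \<Rightarrow> cl31) \<Rightarrow> stvec \<Rightarrow> cl31" where
  "chirp_op \<alpha> \<beta> \<kappa> h w = (\<integral>z. rot (- (fst w * fst z))
     (\<alpha> * (snd z \<bullet> snd z) + \<beta> * (snd w \<bullet> snd w) - \<kappa> * (snd z \<bullet> snd w)) (h z) \<partial>lborel)"

text \<open>The transform for \<open>b = 0\<close> without its constant, the delta integrated out:
  \<gamma> and \<delta> will be \<open>c * d / 2\<close> and \<open>d\<close>.\<close>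

definition slice_op :: "real \<Rightarrow> real \<Rightarrow> (stvec \<Rightarrow> cl31) \<Rightarrow> stvec \<Rightarrow> cl31" where
  "slice_op \<gamma> \<delta> h w = (\<integral>t. rot (- (fst w * t)) (\<gamma> * (snd w \<bullet> snd w)) (h (t, \<delta> *\<^sub>R snd w)) \<partial>lborel)"

lemma borel_measurable_chirp_op [measurable]:
  assumes [measurable]: "h \<in> borel_measurable borel"
  shows "chirp_op \<alpha> \<beta> \<kappa> h \<in> borel_measurable borel"
  unfolding chirp_op_def[abs_def] by measurable

lemma borel_measurable_slice_op [measurable]:
  assumes [measurable]: "h \<in> borel_measurable borel"
  shows "slice_op \<gamma> \<delta> h \<in> borel_measurable borel"
  unfolding slice_op_def[abs_def] by measurable

text \<open>The phase splits into a chirp in \<open>w\<close>, which leaves the integral, a chirp in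
  \<open>z\<close>, which joins the signal, and a bilinear part. The latter is the Fourier kernel at
  the frequency whose spatial part is scaled by \<open>s * \<kappa>\<close>.\<close>

lemma cl_coord_chirp_op:
  assumes h: "integrable lborel h" and s: "s * s = 1"
  shows "cl_coord q s (chirp_op \<alpha> \<beta> \<kappa> h w) = cis (s * \<beta> * (snd w \<bullet> snd w)) *
    fourier (\<lambda>z. cis (s * \<alpha> * (snd z \<bullet> snd z)) * cl_coord q s (h z)) (fst w, (s * \<kappa>) *\<^sub>R snd w)"
proof -
  have "cl_coord q s (chirp_op \<alpha> \<beta> \<kappa> h w) = (\<integral>z. cis (- (fst w * fst z)) *
     cis (s * (\<alpha> * (snd z \<bullet> snd z) + \<beta> * (snd w \<bullet> snd w) - \<kappa> * (snd z \<bullet> snd w))) * cl_coord q s (h z) \<partial>lborel)"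
    unfolding chirp_op_def by (subst cl_coord_integral) (simp_all add: integrable_rot h cl_coord_rot s)
  also have "\<dots> = (\<integral>z. cis (s * \<beta> * (snd w \<bullet> snd w)) * (cis (- ((fst w, (s * \<kappa>) *\<^sub>R snd w) \<bullet> z)) *
      (cis (s * \<alpha> * (snd z \<bullet> snd z)) * cl_coord q s (h z))) \<partial>lborel)"
    unfolding mult.assoc[symmetric] cis_mult
    by (intro Bochner_Integration.integral_cong refl arg_cong2[where f = "(*)"] arg_cong[where f = cis])
      (simp add: inner_prod_def inner_commute algebra_simps)
  finally show ?thesis
    unfolding fourier_def by simp
qed

text \<open>Both chirps have modulus 1, and the spatial dilation by \<open>s * \<kappa>\<close> has
  the same Jacobian for either sign \<open>s\<close>, so all coordinates obey the same identity and
  can be recombined.\<close>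

lemma chirp_op_isometry:
  assumes h: "integrable lborel h" and h2: "integrable lborel (\<lambda>z. (norm (h z))\<^sup>2)" and \<kappa>: "\<kappa> \<noteq> 0"
  shows "ennreal (\<bar>\<kappa>\<bar> ^ 3) * (\<integral>\<^sup>+w. ennreal ((norm (chirp_op \<alpha> \<beta> \<kappa> h w))\<^sup>2) \<partial>lborel) =
    ennreal ((2 * pi) ^ 4) * (\<integral>\<^sup>+z. ennreal ((norm (h z))\<^sup>2) \<partial>lborel)"
proof -
  have [measurable]: "h \<in> borel_measurable borel"
    using h by (auto dest: borel_measurable_integrable)
  have coord: "ennreal (\<bar>\<kappa>\<bar> ^ 3) * (\<integral>\<^sup>+w. ennreal ((cmod (cl_coord q s (chirp_op \<alpha> \<beta> \<kappa> h w)))\<^sup>2) \<partial>lborel) =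
      ennreal ((2 * pi) ^ 4) * (\<integral>\<^sup>+z. ennreal ((cmod (cl_coord q s (h z)))\<^sup>2) \<partial>lborel)"
    if s: "s \<in> {1, - 1}" and q: "q \<in> Basis" for s q
  proof -
    let ?p = "\<lambda>z. cis (s * \<alpha> * (snd z \<bullet> snd z)) * cl_coord q s (h z)"
    have ss: "s * s = 1" "\<bar>s * \<kappa>\<bar> = \<bar>\<kappa>\<bar>" "s * \<kappa> \<noteq> 0" using s \<kappa> by auto
    have p: "integrable lborel ?p"
      by (rule Bochner_Integration.integrable_bound[OF integrable_cl_coord[OF h, of q s]]) (auto simp: norm_mult)
    have p2: "integrable lborel (\<lambda>z. (cmod (?p z))\<^sup>2)"
      using integrable_cl_coord_square[OF _ h2 s q] by (simp add: norm_mult)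
    have "ennreal (\<bar>\<kappa>\<bar> ^ 3) * (\<integral>\<^sup>+w. ennreal ((cmod (cl_coord q s (chirp_op \<alpha> \<beta> \<kappa> h w)))\<^sup>2) \<partial>lborel) =
        ennreal (\<bar>s * \<kappa>\<bar> ^ DIM(real ^ 3)) * (\<integral>\<^sup>+w. ennreal ((cmod (fourier ?p (fst w, (s * \<kappa>) *\<^sub>R snd w)))\<^sup>2) \<partial>lborel)"
      unfolding cl_coord_chirp_op[OF h ss(1)] ss(2) by (simp add: norm_mult)
    also have "\<dots> = (\<integral>\<^sup>+w. ennreal ((cmod (fourier ?p w))\<^sup>2) \<partial>lborel)"
      by (rule nn_integral_dilate_snd[symmetric, OF _ ss(3)]) measurable
    also have "\<dots> = ennreal ((2 * pi) ^ DIM(stvec)) * (\<integral>\<^sup>+z. ennreal ((cmod (?p z))\<^sup>2) \<partial>lborel)"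
      by (rule nn_plancherel[OF p p2])
    finally show ?thesis by (simp add: norm_mult)
  qed
  have "8 * (ennreal (\<bar>\<kappa>\<bar> ^ 3) * (\<integral>\<^sup>+w. ennreal ((norm (chirp_op \<alpha> \<beta> \<kappa> h w))\<^sup>2) \<partial>lborel)) =
      8 * (ennreal ((2 * pi) ^ 4) * (\<integral>\<^sup>+z. ennreal ((norm (h z))\<^sup>2) \<partial>lborel))"
    unfolding mult.left_commute[of 8]
    by (subst (1 2) nn_integral_cl_coord) (simp_all only: sum_distrib_left coord cong: sum.cong, measurable)
  then show ?thesis
    by (simp add: ennreal_mult_cancel_left)
qed

text \<open>By Tonelli almost every time slice is square integrable, and its support in a bounded
  time interval then makes it integrable. The dilation in space preserves this since \<delta> is not
  0.\<close>

lemma AE_slice_integrable: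
  assumes [measurable]: "h \<in> borel_measurable borel" and h2: "integrable lborel (\<lambda>z. (norm (h z))\<^sup>2)"
    and supp: "\<And>z. R < \<bar>fst z\<bar> \<Longrightarrow> h z = 0" and \<delta>: "\<delta> \<noteq> 0"
  shows "AE w in lborel. integrable lborel (\<lambda>t. h (t, \<delta> *\<^sub>R w) :: cl31) \<and>
    integrable lborel (\<lambda>t::real. (norm (h (t, \<delta> *\<^sub>R w :: real ^ 3)))\<^sup>2)"
proof -
  have "ennreal (\<bar>\<delta>\<bar> ^ DIM(real ^ 3)) * (\<integral>\<^sup>+z. ennreal ((norm (h (fst z, \<delta> *\<^sub>R snd z)))\<^sup>2) \<partial>lborel) =
      (\<integral>\<^sup>+z. ennreal ((norm (h z))\<^sup>2) \<partial>lborel)"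
    using \<delta> by (intro nn_integral_dilate_snd[symmetric]) measurable
  also have "\<dots> < \<infinity>"
    using h2 by (simp add: nn_integral_eq_integral)
  finally have "(\<integral>\<^sup>+z. ennreal ((norm (h (fst z, \<delta> *\<^sub>R snd z)))\<^sup>2) \<partial>lborel) \<noteq> \<infinity>"
    using \<delta> by (auto simp: ennreal_mult_less_top)
  then have "(\<integral>\<^sup>+w. \<integral>\<^sup>+t. ennreal ((norm (h (t, \<delta> *\<^sub>R w)))\<^sup>2) \<partial>lborel \<partial>lborel) \<noteq> \<infinity>"
    by (subst (asm) nn_integral_lborel_pair) simp_all
  then have "AE w in lborel. (\<integral>\<^sup>+t. ennreal ((norm (h (t, \<delta> *\<^sub>R w)))\<^sup>2) \<partial>lborel) \<noteq> \<infinity>"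
    by (intro nn_integral_PInf_AE) measurable
  then show ?thesis
  proof eventually_elim
    case (elim w)
    then have "integrable lborel (\<lambda>t. (norm (h (t, \<delta> *\<^sub>R w)))\<^sup>2)"
      by (simp add: integrable_iff_bounded less_top)
    moreover from this have "integrable lborel (\<lambda>t. h (t, \<delta> *\<^sub>R w))"
      by (rule integrable_L2_bounded_support[rotated, where R = R]) (simp_all add: supp)
    ultimately show ?case by simp
  qed
qed

lemma cl_coord_slice_op:
  assumes h: "integrable lborel (\<lambda>t. h (t, \<delta> *\<^sub>R snd w))" and s: "s * s = 1"
  shows "cl_coord q s (slice_op \<gamma> \<delta> h w) = cis (s * \<gamma> * (snd w \<bullet> snd w)) *
    fourier (\<lambda>t. cl_coord q s (h (t, \<delta> *\<^sub>R snd w))) (fst w)"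
proof -
  have "cl_coord q s (slice_op \<gamma> \<delta> h w) = (\<integral>t. cis (- (fst w * t)) *
     cis (s * (\<gamma> * (snd w \<bullet> snd w))) * cl_coord q s (h (t, \<delta> *\<^sub>R snd w)) \<partial>lborel)"
    unfolding slice_op_def by (subst cl_coord_integral) (simp_all add: integrable_rot h cl_coord_rot s)
  also have "\<dots> = (\<integral>t. cis (s * \<gamma> * (snd w \<bullet> snd w)) * (cis (- (fst w \<bullet> t)) * cl_coord q s (h (t, \<delta> *\<^sub>R snd w))) \<partial>lborel)"
    by (intro Bochner_Integration.integral_cong refl) (simp add: mult_ac)
  finally show ?thesis
    unfolding fourier_def by simp
qed

text \<open>One-dimensional Plancherel on almost every slice gives the factor \<open>2 * pi\<close>;
  integration over space and the dilation by \<delta> give the Jacobian.\<close>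

lemma slice_op_isometry:
  assumes [measurable]: "h \<in> borel_measurable borel" and h2: "integrable lborel (\<lambda>z. (norm (h z))\<^sup>2)"
    and supp: "\<And>z. R < \<bar>fst z\<bar> \<Longrightarrow> h z = 0" and \<delta>: "\<delta> \<noteq> 0"
  shows "ennreal (\<bar>\<delta>\<bar> ^ 3) * (\<integral>\<^sup>+w. ennreal ((norm (slice_op \<gamma> \<delta> h w))\<^sup>2) \<partial>lborel) =
    ennreal (2 * pi) * (\<integral>\<^sup>+z. ennreal ((norm (h z))\<^sup>2) \<partial>lborel)"
proof -
  have AE: "AE w in lborel. integrable lborel (\<lambda>t. h (t, \<delta> *\<^sub>R w)) \<and>
      integrable lborel (\<lambda>t. (norm (h (t, \<delta> *\<^sub>R w)))\<^sup>2)"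
    by (rule AE_slice_integrable[where R = R]; fact)
  have coord: "ennreal (\<bar>\<delta>\<bar> ^ 3) * (\<integral>\<^sup>+w. ennreal ((cmod (cl_coord q s (slice_op \<gamma> \<delta> h w)))\<^sup>2) \<partial>lborel) =
      ennreal (2 * pi) * (\<integral>\<^sup>+z. ennreal ((cmod (cl_coord q s (h z)))\<^sup>2) \<partial>lborel)"
    if s: "s \<in> {1, - 1}" and q: "q \<in> Basis" for s q
  proof -
    have ss: "s * s = 1" using s by auto
    have "(\<integral>\<^sup>+w. ennreal ((cmod (cl_coord q s (slice_op \<gamma> \<delta> h w)))\<^sup>2) \<partial>lborel) =
        (\<integral>\<^sup>+x. \<integral>\<^sup>+t. ennreal ((cmod (cl_coord q s (slice_op \<gamma> \<delta> h (t, x))))\<^sup>2) \<partial>lborel \<partial>lborel)"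
      by (rule nn_integral_lborel_pair) measurable
    also have "\<dots> = (\<integral>\<^sup>+x. ennreal (2 * pi) * (\<integral>\<^sup>+t. ennreal ((cmod (cl_coord q s (h (t, \<delta> *\<^sub>R x))))\<^sup>2) \<partial>lborel) \<partial>lborel)"
    proof (rule nn_integral_cong_AE, use AE in eventually_elim)
      case (elim x)
      then have h: "integrable lborel (\<lambda>t. h (t, \<delta> *\<^sub>R x))" "integrable lborel (\<lambda>t. (norm (h (t, \<delta> *\<^sub>R x)))\<^sup>2)"
        by auto
      have "(\<integral>\<^sup>+t. ennreal ((cmod (cl_coord q s (slice_op \<gamma> \<delta> h (t, x))))\<^sup>2) \<partial>lborel) =
          (\<integral>\<^sup>+t. ennreal ((cmod (fourier (\<lambda>t. cl_coord q s (h (t, \<delta> *\<^sub>R x))) t))\<^sup>2) \<partial>lborel)"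
        using h by (subst cl_coord_slice_op[OF _ ss]) (simp_all add: norm_mult)
      also have "\<dots> = ennreal ((2 * pi) ^ DIM(real)) * (\<integral>\<^sup>+t. ennreal ((cmod (cl_coord q s (h (t, \<delta> *\<^sub>R x))))\<^sup>2) \<partial>lborel)"
        by (intro nn_plancherel integrable_cl_coord integrable_cl_coord_square h s q) measurable
      finally show ?case by simp
    qed
    also have "\<dots> = ennreal (2 * pi) * (\<integral>\<^sup>+x. \<integral>\<^sup>+t. ennreal ((cmod (cl_coord q s (h (t, \<delta> *\<^sub>R x))))\<^sup>2) \<partial>lborel \<partial>lborel)"
      by (rule nn_integral_cmult) measurable
    also have "(\<integral>\<^sup>+x. \<integral>\<^sup>+t. ennreal ((cmod (cl_coord q s (h (t, \<delta> *\<^sub>R x))))\<^sup>2) \<partial>lborel \<partial>lborel) =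
        (\<integral>\<^sup>+z. ennreal ((cmod (cl_coord q s (h (fst z, \<delta> *\<^sub>R snd z))))\<^sup>2) \<partial>lborel)"
      by (subst nn_integral_lborel_pair) simp_all
    finally show ?thesis
      using nn_integral_dilate_snd[of "\<lambda>z. ennreal ((cmod (cl_coord q s (h z)))\<^sup>2)", OF _ \<delta>]
      by (simp add: mult.left_commute)
  qed
  have "8 * (ennreal (\<bar>\<delta>\<bar> ^ 3) * (\<integral>\<^sup>+w. ennreal ((norm (slice_op \<gamma> \<delta> h w))\<^sup>2) \<partial>lborel)) =
      8 * (ennreal (2 * pi) * (\<integral>\<^sup>+z. ennreal ((norm (h z))\<^sup>2) \<partial>lborel))"
    unfolding mult.left_commute[of 8]
    by (subst (1 2) nn_integral_cl_coord) (simp_all only: sum_distrib_left coord cong: sum.cong, measurable)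
  then show ?thesis
    by (simp add: ennreal_mult_cancel_left)
qed

subsection \<open>Windowed transforms\<close>

lemma AE_lborel_snd:
  assumes "AE x in lborel. P (x :: 'b::euclidean_space)"
  shows "AE z in lborel. P (snd (z :: 'a::euclidean_space \<times> 'b))"
proof -
  obtain N where N: "{x. \<not> P x} \<subseteq> N" "N \<in> null_sets lborel"
    using assms by (auto simp: eventually_ae_filter)
  have "emeasure (lborel \<Otimes>\<^sub>M lborel) ((UNIV :: 'a set) \<times> N) = 0"
    using N(2) by (subst lborel.emeasure_pair_measure_Times) auto
  then have "(UNIV :: 'a set) \<times> N \<in> null_sets lborel"
    using N(2) unfolding lborel_prod[symmetric] by (intro null_setsI) auto
  then show ?thesis
    by (rule AE_I') (use N(1) in auto)
qed

lemma AE_lborel_slice: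
  assumes "AE z in lborel. P (z :: 'a::euclidean_space \<times> 'b::euclidean_space)"
  shows "AE x in lborel. AE t in lborel. P (t, x)"
proof -
  obtain N where N: "{z. \<not> P z} \<subseteq> N" "N \<in> null_sets (lborel :: ('a \<times> 'b) measure)"
    using assms by (auto simp: eventually_ae_filter)
  then have [measurable]: "N \<in> sets borel" by auto
  have "AE z in lborel \<Otimes>\<^sub>M lborel. z \<notin> N"
    unfolding lborel_prod using N(2) by (rule AE_not_in)
  then have "AE t in lborel. AE x in lborel. (t, x) \<notin> N"
    by (rule lborel_pair.AE_pair)
  then have "AE x in lborel. AE t in lborel. (t, x) \<notin> N"
    by (subst (asm) lborel_pair.AE_commute) measurable
  then show ?thesis
  proof (rule eventually_mono)
    fix x assume "AE t in lborel. (t, x) \<notin> N"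
    then show "AE t in lborel. P (t, x)"
      by (rule eventually_mono) (use N(1) in auto)
  qed
qed

lemma AE_lborel_dilate:
  assumes "AE x in lborel. P (x :: 'a::euclidean_space)" and c: "c \<noteq> 0"
  shows "AE x in lborel. P (c *\<^sub>R x)"
proof -
  obtain N where N: "{x. \<not> P x} \<subseteq> N" "N \<in> null_sets lborel"
    using assms(1) by (auto simp: eventually_ae_filter)
  then have [measurable]: "N \<in> sets borel" by auto
  have "(\<integral>\<^sup>+x. indicator N x \<partial>lborel) = 0"
    using N(2) by auto
  then have "(\<integral>\<^sup>+x. indicator N (c *\<^sub>R x) \<partial>lborel) = 0"
    using c by (subst (asm) nn_integral_dilate[OF _ c]) auto
  then have "AE x in lborel. indicator N (c *\<^sub>R x) = (0::ennreal)"
    by (subst (asm) nn_integral_0_iff_AE) auto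
  then show ?thesis
    by eventually_elim (use N(1) in \<open>auto simp: indicator_def split: if_splits\<close>)
qed

lemma chirp_op_diff:
  assumes "integrable lborel h" "integrable lborel k"
  shows "chirp_op \<alpha> \<beta> \<kappa> (\<lambda>z. h z - k z) w = chirp_op \<alpha> \<beta> \<kappa> h w - chirp_op \<alpha> \<beta> \<kappa> k w"
proof -
  have "integrable lborel (\<lambda>z. rot (- (fst w * fst z))
     (\<alpha> * (snd z \<bullet> snd z) + \<beta> * (snd w \<bullet> snd w) - \<kappa> * (snd z \<bullet> snd w)) (g z))" if "integrable lborel g" for g
    by (rule integrable_rot[OF _ _ that]) measurable
  then show ?thesis
    unfolding chirp_op_def linear_diff[OF linear_rot] using assms by (simp only: Bochner_Integration.integral_diff)
qed

lemma slice_op_diff: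
  assumes "integrable lborel (\<lambda>t. h (t, \<delta> *\<^sub>R snd w))" "integrable lborel (\<lambda>t. k (t, \<delta> *\<^sub>R snd w))"
  shows "slice_op \<gamma> \<delta> (\<lambda>z. h z - k z) w = slice_op \<gamma> \<delta> h w - slice_op \<gamma> \<delta> k w"
proof -
  have "integrable lborel (\<lambda>t. rot (- (fst w * t)) (\<gamma> * (snd w \<bullet> snd w)) (g t))" if "integrable lborel g" for g
    by (rule integrable_rot[OF _ _ that]) measurable
  then show ?thesis
    unfolding slice_op_def linear_diff[OF linear_rot] using assms by (simp only: Bochner_Integration.integral_diff)
qed

definition lcst_borel :: "real \<Rightarrow> real \<Rightarrow> real \<Rightarrow> real \<Rightarrow> (stvec \<Rightarrow> cl31) \<Rightarrow> stvec \<Rightarrow> cl31" where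
  "lcst_borel a b c d h w =
    (if b \<noteq> 0 then (1 / (2 * pi * \<bar>b\<bar>) powr (3/2)) *\<^sub>R chirp_op (a / (2 * b)) (d / (2 * b)) (1 / b) h w
     else (\<bar>d\<bar> powr (3/2)) *\<^sub>R slice_op (c * d / 2) d h w)"

text \<open>The defining integral itself, over \<open>lebesgue\<close>. Its properties are derived
  from \<open>lcst_borel\<close>, with which it agrees almost everywhere once the signal is replaced
  by a Borel representative.\<close>

definition lcst_op :: "real \<Rightarrow> real \<Rightarrow> real \<Rightarrow> real \<Rightarrow> (stvec \<Rightarrow> cl31) \<Rightarrow> stvec \<Rightarrow> cl31" where
  "lcst_op a b c d h w =
    (if b \<noteq> 0 then
       (\<integral>z. (1 / (2 * pi * \<bar>b\<bar>) powr (3/2)) *\<^sub>R rot (- (fst w * fst z))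
         (a / (2 * b) * (snd z \<bullet> snd z) + d / (2 * b) * (snd w \<bullet> snd w) - (1 / b) * (snd z \<bullet> snd w)) (h z) \<partial>lebesgue)
     else (\<integral>t. (\<bar>d\<bar> powr (3/2)) *\<^sub>R rot (- (fst w * t)) (c * d / 2 * (snd w \<bullet> snd w)) (h (t, d *\<^sub>R snd w)) \<partial>lebesgue))"

text \<open>For \<open>b = 0\<close> the delta kernel leaves no integration in space, so the
  truncation is in time only and the window is a slab.\<close>

definition window :: "real \<Rightarrow> real \<Rightarrow> stvec set" where
  "window b R = (if b \<noteq> 0 then cball 0 R else {- R..R} \<times> UNIV)"

lemma window_borel [measurable]: "window b R \<in> sets borel"
  unfolding window_def by (auto intro!: borel_closed closed_Times)

lemma window_mono: "R \<le> S \<Longrightarrow> window b R \<subseteq> window b S"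
  by (auto simp: window_def)

lemma mem_window: "norm z \<le> R \<Longrightarrow> z \<in> window b R"
  using norm_fst_le[of "fst z" "snd z"] by (auto simp: window_def mem_Times_iff abs_le_iff)

lemma notin_window: "b \<noteq> 0 \<Longrightarrow> R < norm z \<Longrightarrow> z \<notin> window b R" "R < \<bar>fst z\<bar> \<Longrightarrow> z \<notin> window 0 R"
  by (auto simp: window_def mem_Times_iff)

text \<open>Truncating the integral amounts to cutting the signal, so all truncated transforms are
  values of one operator, and differences of truncations become transforms of differences.\<close>

lemma lcst_trunc_eq: "lcst_trunc a b c d R f = lcst_op a b c d (\<lambda>z. indicator (window b R) z *\<^sub>R f z)"
proof (rule ext)
  fix w :: stvec
  have mult: "cl_mult (cl_mult (cl_exp e_t \<theta>) v) (k *\<^sub>R cl_exp i3 \<phi>) = k *\<^sub>R rot \<theta> \<phi> v" for \<theta> \<phi> k v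
    using bilinear_cl_mult by (simp add: rot_def bilinear_rmul)
  show "lcst_trunc a b c d R f w = lcst_op a b c d (\<lambda>z. indicator (window b R) z *\<^sub>R f z) w"
  proof (cases "b = 0")
    case True
    have "indicator (window b R) (t, x) = (indicator {- R..R} t :: real)" for t x
      using True by (simp add: window_def indicator_def)
    then show ?thesis
      using True by (simp add: lcst_trunc_def lcst_op_def mult linear_scale[OF linear_rot] case_prod_beta mult_ac)
  next
    case False
    have "window b R = cball 0 R"
      using False by (simp add: window_def)
    then show ?thesis
      using False by (simp add: lcst_trunc_def lcst_op_def lcst_kernel_def mult linear_scale[OF linear_rot] case_prod_beta mult_ac)
  qed
qed

definition windowed :: "real \<Rightarrow> real \<Rightarrow> (stvec \<Rightarrow> cl31) \<Rightarrow> bool" where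
  "windowed b R h \<longleftrightarrow> h \<in> borel_measurable lebesgue \<and> integrable lebesgue (\<lambda>z. (norm (h z))\<^sup>2) \<and> (\<forall>z. z \<notin> window b R \<longrightarrow> h z = 0)"

lemma windowed_zero: "windowed b R h \<Longrightarrow> z \<notin> window b R \<Longrightarrow> h z = 0"
  unfolding windowed_def by blast

lemma windowed_integrable:
  assumes "b \<noteq> 0" "windowed b R h" and [measurable]: "h \<in> borel_measurable borel"
  shows "integrable lborel h"
proof (rule integrable_L2_bounded_support[where R = R])
  show "integrable lborel (\<lambda>z. (norm (h z))\<^sup>2)"
    using assms(2) by (subst integrable_completion[symmetric]) (auto simp: windowed_def)
  show "h z = 0" if "R < norm z" for z
    using notin_window(1)[OF assms(1) that] by (rule windowed_zero[OF assms(2)])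
qed fact

lemma windowed_slices:
  assumes "d \<noteq> 0" "windowed 0 R h" and [measurable]: "h \<in> borel_measurable borel"
  shows "AE w in lborel. integrable lborel (\<lambda>t. h (t, d *\<^sub>R snd (w :: stvec)))"
proof -
  have "AE x in lborel. integrable lborel (\<lambda>t. h (t, d *\<^sub>R x)) \<and> integrable lborel (\<lambda>t. (norm (h (t, d *\<^sub>R x)))\<^sup>2)"
  proof (rule AE_slice_integrable[where R = R])
    show "integrable lborel (\<lambda>z. (norm (h z))\<^sup>2)"
      using assms(2) by (subst integrable_completion[symmetric]) (auto simp: windowed_def)
    show "h z = 0" if "R < \<bar>fst z\<bar>" for z
      using notin_window(2)[OF that] by (rule windowed_zero[OF assms(2)])
  qed fact+
  then have "AE x in lborel. integrable lborel (\<lambda>t. h (t, d *\<^sub>R x))"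
    by (rule eventually_mono) simp
  then show ?thesis by (rule AE_lborel_snd)
qed

lemma powr_three_halves_square: "0 < (x::real) \<Longrightarrow> (x powr (3/2))\<^sup>2 = x ^ 3"
  by (simp add: powr_powr powr_numeral flip: powr_realpow[of "x powr (3/2)"])

lemma borel_measurable_lcst_borel [measurable]:
  assumes [measurable]: "h \<in> borel_measurable borel"
  shows "lcst_borel a b c d h \<in> borel_measurable borel"
  unfolding lcst_borel_def[abs_def] by measurable

lemma nn_integral_scaleR_square:
  assumes [measurable]: "h \<in> borel_measurable M"
  shows "(\<integral>\<^sup>+z. ennreal ((norm (r *\<^sub>R h z))\<^sup>2) \<partial>M) = ennreal (r\<^sup>2) * (\<integral>\<^sup>+z. ennreal ((norm (h z))\<^sup>2) \<partial>M)"
  by (simp add: power_mult_distrib ennreal_mult nn_integral_cmult)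

lemma lcst_borel_isometry:
  assumes det: "a * d - b * c = 1" and h: "windowed b R h" and [measurable]: "h \<in> borel_measurable borel"
  shows "(\<integral>\<^sup>+w. ennreal ((norm (lcst_borel a b c d h w))\<^sup>2) \<partial>lborel) = ennreal (2 * pi) * (\<integral>\<^sup>+z. ennreal ((norm (h z))\<^sup>2) \<partial>lborel)"
proof -
  have h2: "integrable lborel (\<lambda>z. (norm (h z))\<^sup>2)"
    using h by (subst integrable_completion[symmetric]) (auto simp: windowed_def)
  show ?thesis
  proof (cases "b = 0")
    case True
    then have d: "d \<noteq> 0" using det by auto
    have "ennreal (\<bar>d\<bar> ^ 3) * (\<integral>\<^sup>+w. ennreal ((norm (slice_op (c * d / 2) d h w))\<^sup>2) \<partial>lborel) =
        ennreal (2 * pi) * (\<integral>\<^sup>+z. ennreal ((norm (h z))\<^sup>2) \<partial>lborel)"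
    proof (rule slice_op_isometry[where R = R])
      show "h z = 0" if "R < \<bar>fst z\<bar>" for z
        using notin_window(2)[OF that] by (rule windowed_zero[OF h[unfolded True]])
    qed fact+
    \<comment> \<open>The squared weight is \<open>\<bar>d\<bar> ^ 3\<close>, exactly the Jacobian
      of the dilation of the three space variables.\<close>
    then show ?thesis
      using True d by (simp add: lcst_borel_def nn_integral_scaleR_square powr_three_halves_square del: norm_scaleR)
  next
    case False
    let ?I = "\<integral>\<^sup>+w. ennreal ((norm (chirp_op (a / (2 * b)) (d / (2 * b)) (1 / b) h w))\<^sup>2) \<partial>lborel"
    let ?N = "\<integral>\<^sup>+z. ennreal ((norm (h z))\<^sup>2) \<partial>lborel"
    have "ennreal (\<bar>1 / b\<bar> ^ 3) * ?I = ennreal ((2 * pi) ^ 4) * ?N"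
      using False by (intro chirp_op_isometry windowed_integrable[OF False h] h2) auto
    \<comment> \<open>The squared kernel constant splits into \<open>(1 / (2 * pi)) ^ 3\<close>,
      which reduces the four-dimensional \<open>(2 * pi) ^ 4\<close> to \<open>2 * pi\<close>, and
      \<open>\<bar>1 / b\<bar> ^ 3\<close>, which is the Jacobian of the dilation.\<close>
    then have "ennreal ((1 / (2 * pi)) ^ 3) * (ennreal (\<bar>1 / b\<bar> ^ 3) * ?I) = ennreal ((1 / (2 * pi)) ^ 3) * (ennreal ((2 * pi) ^ 4) * ?N)"
      by simp
    moreover have "(1 / (2 * pi * \<bar>b\<bar>) powr (3/2))\<^sup>2 = (1 / (2 * pi)) ^ 3 * \<bar>1 / b\<bar> ^ 3"
      using False by (simp add: power_divide powr_three_halves_square power_mult_distrib)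
    moreover have "(1 / (2 * pi)) ^ 3 * (2 * pi) ^ 4 = 2 * pi"
      by (simp add: power_divide power_mult_distrib eval_nat_numeral)
    ultimately have "ennreal ((1 / (2 * pi * \<bar>b\<bar>) powr (3/2))\<^sup>2) * ?I = ennreal (2 * pi) * ?N"
      by (simp only: ennreal_mult'[symmetric] mult.assoc[symmetric] zero_le_power zero_le_divide_1_iff pi_ge_zero zero_le_mult_iff zero_le_numeral abs_ge_zero simp_thms)
    then show ?thesis
      using False by (simp add: lcst_borel_def nn_integral_scaleR_square del: norm_scaleR)
  qed
qed

text \<open>For \<open>b = 0\<close> additivity of the integral is available only where both slices
  are integrable, hence the equality almost everywhere.\<close>

lemma lcst_borel_diff:
  assumes det: "a * d - b * c = 1" and h: "windowed b R h" "h \<in> borel_measurable borel"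
    and k: "windowed b R k" "k \<in> borel_measurable borel"
  shows "AE w in lborel. lcst_borel a b c d (\<lambda>z. h z - k z) w = lcst_borel a b c d h w - lcst_borel a b c d k w"
proof (cases "b = 0")
  case True
  then have d: "d \<noteq> 0" using det by auto
  show ?thesis
    using windowed_slices[OF d h[unfolded True]] windowed_slices[OF d k[unfolded True]]
    by eventually_elim (simp add: lcst_borel_def True slice_op_diff scaleR_diff_right)
next
  case False
  then show ?thesis
    using windowed_integrable[OF False h] windowed_integrable[OF False k]
    by (simp add: lcst_borel_def chirp_op_diff scaleR_diff_right)
qed

text \<open>For \<open>b \<noteq> 0\<close> the integral runs over all of space-time and ignores
  null sets, so equality holds at every \<open>w\<close>. For \<open>b = 0\<close> it sees a single
  slice, and only almost every slice meets the exceptional set in a null set.\<close>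

lemma lcst_op_AE_borel:
  assumes det: "a * d - b * c = 1" and h: "h \<in> borel_measurable lebesgue"
    and h'[measurable]: "h' \<in> borel_measurable borel" and eq: "AE z in lborel. h z = h' z"
  shows "AE w in lborel. lcst_op a b c d h w = lcst_borel a b c d h' w"
proof (cases "b = 0")
  case False
  have "lcst_op a b c d h w = lcst_borel a b c d h' w" for w
  proof -
    let ?K = "1 / (2 * pi * \<bar>b\<bar>) powr (3/2)"
    let ?\<theta> = "\<lambda>z. - (fst w * fst z)"
    let ?\<phi> = "\<lambda>z. a / (2 * b) * (snd z \<bullet> snd z) + d / (2 * b) * (snd w \<bullet> snd w) - (1 / b) * (snd z \<bullet> snd w)"
    have [measurable]: "?\<theta> \<in> borel_measurable lebesgue" "?\<phi> \<in> borel_measurable lebesgue" "h' \<in> borel_measurable lebesgue"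
      by (rule measurable_completion, measurable)+
    note h[measurable]
    have "(\<integral>z. ?K *\<^sub>R rot (?\<theta> z) (?\<phi> z) (h z) \<partial>lebesgue) = (\<integral>z. ?K *\<^sub>R rot (?\<theta> z) (?\<phi> z) (h' z) \<partial>lebesgue)"
    proof (rule integral_cong_AE)
      show "AE z in lebesgue. ?K *\<^sub>R rot (?\<theta> z) (?\<phi> z) (h z) = ?K *\<^sub>R rot (?\<theta> z) (?\<phi> z) (h' z)"
        by (rule AE_completion, rule eventually_mono[OF eq]) simp
    qed measurable
    also have "\<dots> = (\<integral>z. ?K *\<^sub>R rot (?\<theta> z) (?\<phi> z) (h' z) \<partial>lborel)"
      by (rule integral_completion) measurable
    finally show ?thesis
      using False by (simp add: lcst_op_def lcst_borel_def chirp_op_def)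
  qed
  then show ?thesis by simp
next
  case True
  then have d: "d \<noteq> 0" using det by auto
  \<comment> \<open>The null set is sliced by Fubini, the slices are reparametrized by
    \<open>x = d w\<close> with \<open>d \<noteq> 0\<close>, and the condition on \<open>w\<close>
    is lifted to space-time.\<close>
  have "AE w in lborel. AE t in lborel. h (t, d *\<^sub>R snd (w :: stvec)) = h' (t, d *\<^sub>R snd w)"
    by (rule AE_lborel_snd[OF AE_lborel_dilate[OF AE_lborel_slice[OF eq] d]])
  then show ?thesis
  proof eventually_elim
    case (elim w)
    let ?D = "\<bar>d\<bar> powr (3/2)" and ?\<phi> = "c * d / 2 * (snd w \<bullet> snd w)"
    have [measurable]: "(\<lambda>t. - (fst w * t)) \<in> borel_measurable lebesgue" "(\<lambda>t. h' (t, d *\<^sub>R snd w)) \<in> borel_measurable lebesgue"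
      by (rule measurable_completion, measurable)+
    have eq': "AE t in lebesgue. h (t, d *\<^sub>R snd w) = h' (t, d *\<^sub>R snd w)"
      using elim by (rule AE_completion)
    \<comment> \<open>The slice of \<open>h\<close> is measurable because it agrees almost
      everywhere with a Borel slice and \<open>lebesgue\<close> is complete.\<close>
    have [measurable]: "(\<lambda>t. h (t, d *\<^sub>R snd w)) \<in> borel_measurable lebesgue"
      by (rule borel_measurable_AE[OF \<open>(\<lambda>t. h' (t, d *\<^sub>R snd w)) \<in> borel_measurable lebesgue\<close>],
        rule eventually_mono[OF eq']) simp
    have "(\<integral>t. ?D *\<^sub>R rot (- (fst w * t)) ?\<phi> (h (t, d *\<^sub>R snd w)) \<partial>lebesgue) =
        (\<integral>t. ?D *\<^sub>R rot (- (fst w * t)) ?\<phi> (h' (t, d *\<^sub>R snd w)) \<partial>lebesgue)"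
    proof (rule integral_cong_AE)
      show "AE t in lebesgue. ?D *\<^sub>R rot (- (fst w * t)) ?\<phi> (h (t, d *\<^sub>R snd w)) =
          ?D *\<^sub>R rot (- (fst w * t)) ?\<phi> (h' (t, d *\<^sub>R snd w))"
        by (rule eventually_mono[OF eq']) simp
    qed measurable
    also have "\<dots> = (\<integral>t. ?D *\<^sub>R rot (- (fst w * t)) ?\<phi> (h' (t, d *\<^sub>R snd w)) \<partial>lborel)"
      by (rule integral_completion) measurable
    finally show ?case
      using True by (simp add: lcst_op_def lcst_borel_def slice_op_def)
  qed
qed

text \<open>Representatives are chosen coefficient by coefficient. The choice respects the support
  only almost everywhere; the indicator of the window restores it at every point.\<close>

lemma windowed_borel_representative:
  assumes h: "windowed b R h"
  obtains h' where "h' \<in> borel_measurable borel" "AE z in lborel. h z = h' z" "windowed b R h'"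
proof -
  have meas: "h \<in> borel_measurable lebesgue" using h by (simp add: windowed_def)
  have "\<exists>g\<in>borel_measurable lborel. AE z in lborel. h z $ A = g z" for A
    by (intro completion_ex_borel_measurable_real measurable_compose[OF meas] borel_measurable_continuous_onI continuous_intros)
  then have "\<exists>g. \<forall>A. g A \<in> borel_measurable lborel \<and> (AE z in lborel. h z $ A = g A z)"
    by (intro choice) blast
  then obtain g where g: "\<And>A. g A \<in> borel_measurable lborel" "\<And>A. AE z in lborel. h z $ A = g A z"
    by blast
  define h' where "h' z = indicator (window b R) z *\<^sub>R (\<chi> A. g A z)" for z
  have "(\<lambda>z. (\<chi> A. g A z) :: cl31) \<in> borel_measurable borel"
    using g(1) by (subst borel_measurable_euclidean_space) (auto simp: Basis_vec_def inner_axis)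
  then have h'[measurable]: "h' \<in> borel_measurable borel"
    unfolding h'_def by measurable
  have "AE z in lborel. \<forall>A. h z $ A = g A z"
    using g(2) by (subst AE_all_countable) auto
  then have eq: "AE z in lborel. h z = h' z"
  proof eventually_elim
    case (elim z)
    then have "h z = (\<chi> A. g A z)" by (simp add: vec_eq_iff)
    then show ?case
      using windowed_zero[OF h, of z] by (cases "z \<in> window b R") (simp_all add: h'_def)
  qed
  moreover have "windowed b R h'"
    unfolding windowed_def
  proof (intro conjI)
    show h'_leb: "h' \<in> borel_measurable lebesgue" by (simp add: measurable_completion)
    note meas[measurable] h'_leb[measurable]
    have "AE z in lebesgue. (norm (h z))\<^sup>2 = (norm (h' z))\<^sup>2"
      by (rule AE_completion, rule eventually_mono[OF eq]) simp
    then show "integrable lebesgue (\<lambda>z. (norm (h' z))\<^sup>2)"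
      using h by (subst integrable_cong_AE[symmetric]) (auto simp: windowed_def)
  qed (simp add: h'_def)
  ultimately show ?thesis using that h' by blast
qed

lemma windowed_diff:
  assumes "windowed b R h" "windowed b R k"
  shows "windowed b R (\<lambda>z. h z - k z)"
  unfolding windowed_def
proof (intro conjI)
  have [measurable]: "h \<in> borel_measurable lebesgue" "k \<in> borel_measurable lebesgue"
    using assms by (auto simp: windowed_def)
  show "(\<lambda>z. h z - k z) \<in> borel_measurable lebesgue" by measurable
  have "integrable lebesgue (\<lambda>z. (norm (h z))\<^sup>2)" "integrable lebesgue (\<lambda>z. (norm (- k z))\<^sup>2)"
    using assms by (simp_all only: windowed_def norm_minus_cancel)
  note int = this
  have "(\<lambda>z. - k z) \<in> borel_measurable lebesgue" by measurable
  with int have "integrable lebesgue (\<lambda>z. (norm (h z + - k z))\<^sup>2)"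
    using integral_inner_polar(1)[of h lebesgue "\<lambda>z. - k z"] \<open>h \<in> borel_measurable lebesgue\<close> by blast
  then show "integrable lebesgue (\<lambda>z. (norm (h z - k z))\<^sup>2)"
    by (simp only: add_uminus_conv_diff)
  show "\<forall>z. z \<notin> window b R \<longrightarrow> h z - k z = 0"
    using windowed_zero[OF assms(1)] windowed_zero[OF assms(2)] by simp
qed

lemma
  assumes det: "a * d - b * c = 1" and h: "windowed b R h"
  shows lcst_op_measurable: "lcst_op a b c d h \<in> borel_measurable lebesgue"
    and lcst_op_isometry: "(\<integral>\<^sup>+w. ennreal ((norm (lcst_op a b c d h w))\<^sup>2) \<partial>lebesgue) =
      ennreal (2 * pi) * (\<integral>\<^sup>+z. ennreal ((norm (h z))\<^sup>2) \<partial>lebesgue)"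
proof -
  obtain h' where h': "h' \<in> borel_measurable borel" "AE z in lborel. h z = h' z" "windowed b R h'"
    using windowed_borel_representative[OF h] .
  note h'(1)[measurable]
  have meas: "h \<in> borel_measurable lebesgue" using h by (simp add: windowed_def)
  have eq: "AE w in lborel. lcst_op a b c d h w = lcst_borel a b c d h' w"
    by (rule lcst_op_AE_borel[OF det meas h'(1,2)])
  have "lcst_borel a b c d h' \<in> borel_measurable lebesgue"
    by (simp add: measurable_completion)
  moreover have "AE w in lebesgue. lcst_borel a b c d h' w = lcst_op a b c d h w"
    using AE_completion[OF eq] by (rule eventually_mono) simp
  ultimately show "lcst_op a b c d h \<in> borel_measurable lebesgue"
    by (rule borel_measurable_AE)
  have "(\<integral>\<^sup>+w. ennreal ((norm (lcst_op a b c d h w))\<^sup>2) \<partial>lebesgue) = (\<integral>\<^sup>+w. ennreal ((norm (lcst_borel a b c d h' w))\<^sup>2) \<partial>lebesgue)"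
    by (rule nn_integral_cong_AE, rule eventually_mono[OF AE_completion[OF eq]]) simp
  also have "\<dots> = (\<integral>\<^sup>+w. ennreal ((norm (lcst_borel a b c d h' w))\<^sup>2) \<partial>lborel)"
    by (rule nn_integral_completion)
  also have "\<dots> = ennreal (2 * pi) * (\<integral>\<^sup>+z. ennreal ((norm (h' z))\<^sup>2) \<partial>lborel)"
    by (rule lcst_borel_isometry[OF det h'(3,1)])
  also have "(\<integral>\<^sup>+z. ennreal ((norm (h' z))\<^sup>2) \<partial>lborel) = (\<integral>\<^sup>+z. ennreal ((norm (h' z))\<^sup>2) \<partial>lebesgue)"
    by (rule nn_integral_completion[symmetric])
  also have "\<dots> = (\<integral>\<^sup>+z. ennreal ((norm (h z))\<^sup>2) \<partial>lebesgue)"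
    by (rule nn_integral_cong_AE, rule eventually_mono[OF AE_completion[OF h'(2)]]) simp
  finally show "(\<integral>\<^sup>+w. ennreal ((norm (lcst_op a b c d h w))\<^sup>2) \<partial>lebesgue) =
      ennreal (2 * pi) * (\<integral>\<^sup>+z. ennreal ((norm (h z))\<^sup>2) \<partial>lebesgue)" .
qed

lemma lcst_op_diff:
  assumes det: "a * d - b * c = 1" and h: "windowed b R h" and k: "windowed b R k"
  shows "AE w in lebesgue. lcst_op a b c d (\<lambda>z. h z - k z) w = lcst_op a b c d h w - lcst_op a b c d k w"
proof -
  obtain h' where h': "h' \<in> borel_measurable borel" "AE z in lborel. h z = h' z" "windowed b R h'"
    using windowed_borel_representative[OF h] .
  obtain k' where k': "k' \<in> borel_measurable borel" "AE z in lborel. k z = k' z" "windowed b R k'"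
    using windowed_borel_representative[OF k] .
  note h'(1)[measurable] k'(1)[measurable]
  have meas: "h \<in> borel_measurable lebesgue" "k \<in> borel_measurable lebesgue" "(\<lambda>z. h z - k z) \<in> borel_measurable lebesgue"
    using h k windowed_diff[OF h k] by (auto simp: windowed_def)
  have "AE z in lborel. h z - k z = h' z - k' z"
    using h'(2) k'(2) by eventually_elim simp
  then have "AE w in lborel. lcst_op a b c d (\<lambda>z. h z - k z) w = lcst_borel a b c d (\<lambda>z. h' z - k' z) w"
    by (intro lcst_op_AE_borel[OF det meas(3)]) auto
  then have "AE w in lborel. lcst_op a b c d (\<lambda>z. h z - k z) w = lcst_op a b c d h w - lcst_op a b c d k w"
    using lcst_op_AE_borel[OF det meas(1) h'(1,2)] lcst_op_AE_borel[OF det meas(2) k'(1,2)]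
      lcst_borel_diff[OF det h'(3,1) k'(3,1)]
    by eventually_elim simp
  then show ?thesis by (rule AE_completion)
qed

subsection \<open>The limit transform\<close>

lemma L2_iff: "L2 f \<longleftrightarrow> f \<in> borel_measurable lebesgue \<and> integrable lebesgue (\<lambda>z. (norm (f z))\<^sup>2)"
  by (simp add: L2_def cl_abs2_eq_norm)

lemma L2_add: "L2 f \<Longrightarrow> L2 g \<Longrightarrow> L2 (\<lambda>z. f z + g z)"
  unfolding L2_iff using integral_inner_polar(1)[of f lebesgue g] borel_measurable_add[of f lebesgue g] by blast

lemma L2_nn_integral: "L2 f \<Longrightarrow> (\<integral>\<^sup>+z. ennreal ((norm (f z))\<^sup>2) \<partial>lebesgue) = ennreal (\<integral>z. (norm (f z))\<^sup>2 \<partial>lebesgue)"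
  by (simp add: L2_iff nn_integral_eq_integral)

lemma windowed_indicator:
  assumes "L2 f" shows "windowed b R (\<lambda>z. indicator (window b R) z *\<^sub>R f z)"
  unfolding windowed_def
proof (intro conjI)
  have [measurable]: "f \<in> borel_measurable lebesgue" "window b R \<in> sets lebesgue"
    using assms by (auto simp: L2_iff)
  show "(\<lambda>z. indicator (window b R) z *\<^sub>R f z) \<in> borel_measurable lebesgue"
    by measurable
  have "integrable lebesgue (\<lambda>z. (norm (f z))\<^sup>2)"
    using assms by (simp add: L2_iff)
  then show "integrable lebesgue (\<lambda>z. (norm (indicator (window b R) z *\<^sub>R f z))\<^sup>2)"
    by (rule Bochner_Integration.integrable_bound) (measurable, simp add: indicator_def)
qed simp

lemma eventually_window: "eventually (\<lambda>R. z \<in> window b R) at_top"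
  using eventually_ge_at_top[of "norm z"] by (rule eventually_mono) (rule mem_window)

lemma nn_integral_window_tendsto:
  assumes "L2 f"
  shows "((\<lambda>R. \<integral>\<^sup>+z. ennreal ((norm (indicator (window b R) z *\<^sub>R f z))\<^sup>2) \<partial>lebesgue) \<longlongrightarrow>
      ennreal (\<integral>z. (norm (f z))\<^sup>2 \<partial>lebesgue)) at_top" (is "?A")
    and "((\<lambda>R. \<integral>\<^sup>+z. ennreal ((norm (indicator (- window b R) z *\<^sub>R f z))\<^sup>2) \<partial>lebesgue) \<longlongrightarrow> 0) at_top" (is "?B")
proof -
  have [measurable]: "f \<in> borel_measurable lebesgue" "window b R \<in> sets lebesgue" for R
    using assms by (auto simp: L2_iff)
  have f2: "integrable lebesgue (\<lambda>z. (norm (f z))\<^sup>2)" using assms by (simp add: L2_iff)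
  \<comment> \<open>Both claims are cases of this one: windows with pointwise limit
    \<open>r = 1\<close>, their complements with \<open>r = 0\<close>.\<close>
  have lim: "((\<lambda>R. \<integral>\<^sup>+z. ennreal ((norm (indicator (A R) z *\<^sub>R f z))\<^sup>2) \<partial>lebesgue) \<longlongrightarrow>
      ennreal (\<integral>z. r *\<^sub>R (norm (f z))\<^sup>2 \<partial>lebesgue)) at_top"
    if [measurable]: "\<And>R. A R \<in> sets lebesgue" and ev: "\<And>z. eventually (\<lambda>R. indicator (A R) z = r) at_top" for A :: "real \<Rightarrow> stvec set" and r :: real
  proof -
    have int: "integrable lebesgue (\<lambda>z. (norm (indicator (A R) z *\<^sub>R f z))\<^sup>2)" for R
      using f2 by (rule Bochner_Integration.integrable_bound) (auto simp: indicator_def intro!: AE_I2)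
    have "((\<lambda>R. \<integral>z. indicator (A R) z *\<^sub>R (norm (f z))\<^sup>2 \<partial>lebesgue) \<longlongrightarrow> (\<integral>z. r *\<^sub>R (norm (f z))\<^sup>2 \<partial>lebesgue)) at_top"
    proof (rule integral_dominated_convergence_at_top[OF _ _ f2])
      show "AE z in lebesgue. ((\<lambda>R. indicator (A R) z *\<^sub>R (norm (f z))\<^sup>2) \<longlongrightarrow> r *\<^sub>R (norm (f z))\<^sup>2) at_top"
        using ev by (intro AE_I2 tendsto_scaleR tendsto_const tendsto_eventually)
    qed (auto simp: indicator_def intro!: always_eventually)
    moreover have "(norm (indicator (A R) z *\<^sub>R f z))\<^sup>2 = indicator (A R) z *\<^sub>R (norm (f z))\<^sup>2" for R z
      by (simp add: indicator_def)
    ultimately show ?thesis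
      using int by (simp add: nn_integral_eq_integral tendsto_ennrealI)
  qed
  have "eventually (\<lambda>R. indicator (window b R) z = (1::real)) at_top"
    "eventually (\<lambda>R. indicator (- window b R) z = (0::real)) at_top" for z
    by (rule eventually_mono[OF eventually_window[of z b]]; simp)+
  then show ?A ?B
    using lim[of "window b" 1] lim[of "\<lambda>R. - window b R" 0] by auto
qed

lemma lcst_trunc_measurable:
  "a * d - b * c = 1 \<Longrightarrow> L2 f \<Longrightarrow> lcst_trunc a b c d R f \<in> borel_measurable lebesgue"
  unfolding lcst_trunc_eq by (rule lcst_op_measurable[OF _ windowed_indicator])

text \<open>Both cut signals are supported in the larger window, so by isometry the distance is the
  energy between the two windows. The tail outside the smaller one bounds it independently of
  \<open>S\<close>, as \<open>L2_complete_at_top\<close> requires.\<close>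

lemma lcst_trunc_cauchy:
  assumes det: "a * d - b * c = 1" and f: "L2 f" and RS: "R \<le> S"
  shows "(\<integral>\<^sup>+z. ennreal ((norm (lcst_trunc a b c d R f z - lcst_trunc a b c d S f z))\<^sup>2) \<partial>lebesgue) \<le>
    ennreal (2 * pi) * (\<integral>\<^sup>+z. ennreal ((norm (indicator (- window b R) z *\<^sub>R f z))\<^sup>2) \<partial>lebesgue)"
proof -
  let ?f = "\<lambda>R z. indicator (window b R) z *\<^sub>R f z"
  have sub: "window b R \<subseteq> window b S" using RS by (rule window_mono)
  have S: "windowed b S (?f S)" by (rule windowed_indicator[OF f])
  have R: "windowed b S (?f R)"
    using windowed_indicator[OF f, of b R] sub unfolding windowed_def by blast
  have "(\<integral>\<^sup>+z. ennreal ((norm (lcst_trunc a b c d R f z - lcst_trunc a b c d S f z))\<^sup>2) \<partial>lebesgue) =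
      (\<integral>\<^sup>+z. ennreal ((norm (lcst_op a b c d (\<lambda>z. ?f R z - ?f S z) z))\<^sup>2) \<partial>lebesgue)"
    unfolding lcst_trunc_eq by (rule nn_integral_cong_AE, rule eventually_mono[OF lcst_op_diff[OF det R S]]) simp
  also have "\<dots> = ennreal (2 * pi) * (\<integral>\<^sup>+z. ennreal ((norm (?f R z - ?f S z))\<^sup>2) \<partial>lebesgue)"
    by (rule lcst_op_isometry[OF det windowed_diff[OF R S]])
  also have "\<dots> \<le> ennreal (2 * pi) * (\<integral>\<^sup>+z. ennreal ((norm (indicator (- window b R) z *\<^sub>R f z))\<^sup>2) \<partial>lebesgue)"
    using sub by (intro mult_left_mono nn_integral_mono) (auto simp: indicator_def)
  finally show ?thesis .
qed

lemma is_lcst_iff: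
  "is_lcst a b c d f g \<longleftrightarrow> L2 g \<and>
    ((\<lambda>R. \<integral>\<^sup>+z. ennreal ((norm (lcst_trunc a b c d R f z - g z))\<^sup>2) \<partial>lebesgue) \<longlongrightarrow> 0) at_top"
  by (simp add: is_lcst_def cl_abs2_eq_norm)

lemma is_lcst_exists:
  assumes det: "a * d - b * c = 1" and f: "L2 f"
  obtains g where "is_lcst a b c d f g"
proof -
  let ?\<rho> = "\<lambda>R. ennreal (2 * pi) * (\<integral>\<^sup>+z. ennreal ((norm (indicator (- window b R) z *\<^sub>R f z))\<^sup>2) \<partial>lebesgue)"
  have \<rho>: "(?\<rho> \<longlongrightarrow> 0) at_top"
    using tendsto_mult_ennreal[OF tendsto_const[of "ennreal (2 * pi)"] nn_integral_window_tendsto(2)[OF f]] by simp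
  obtain g where g: "g \<in> borel_measurable lebesgue"
    "\<And>R. (\<integral>\<^sup>+z. ennreal ((norm (lcst_trunc a b c d R f z - g z))\<^sup>2) \<partial>lebesgue) \<le> ?\<rho> R"
  proof (rule L2_complete_at_top[where X = "\<lambda>R. lcst_trunc a b c d R f" and M = lebesgue and \<rho> = ?\<rho>])
    show "lcst_trunc a b c d R f \<in> borel_measurable lebesgue" for R
      by (rule lcst_trunc_measurable[OF det f])
    show "(\<integral>\<^sup>+z. ennreal ((norm (lcst_trunc a b c d R f z - lcst_trunc a b c d S f z))\<^sup>2) \<partial>lebesgue) \<le> ?\<rho> R"
      if "R \<le> S" for R S
      by (rule lcst_trunc_cauchy[OF det f that])
  qed (rule \<rho>, rule that)
  have lim: "((\<lambda>R. \<integral>\<^sup>+z. ennreal ((norm (lcst_trunc a b c d R f z - g z))\<^sup>2) \<partial>lebesgue) \<longlongrightarrow> 0) at_top"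
    by (rule tendsto_sandwich[OF _ always_eventually tendsto_const \<rho>]) (simp, intro allI g(2))
  \<comment> \<open>A single truncation at squared distance below 1, with finite norm by isometry,
    shows that the limit is square integrable.\<close>
  have "eventually (\<lambda>R. (\<integral>\<^sup>+z. ennreal ((norm (lcst_trunc a b c d R f z - g z))\<^sup>2) \<partial>lebesgue) < 1) at_top"
    by (rule order_tendstoD(2)[OF lim]) simp
  then obtain R where R: "(\<integral>\<^sup>+z. ennreal ((norm (lcst_trunc a b c d R f z - g z))\<^sup>2) \<partial>lebesgue) < 1"
    using eventually_happens'[OF trivial_limit_at_top_linorder] by blast
  have fin: "(\<integral>\<^sup>+z. ennreal ((norm (lcst_trunc a b c d R f z))\<^sup>2) \<partial>lebesgue) < \<infinity>"
    using windowed_indicator[OF f, of b R]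
    by (simp add: lcst_trunc_eq lcst_op_isometry[OF det windowed_indicator[OF f]] windowed_def nn_integral_eq_integral ennreal_mult_less_top)
  have "(\<integral>\<^sup>+z. ennreal ((norm (g z))\<^sup>2) \<partial>lebesgue) < \<infinity>"
  proof (rule order_le_less_trans[OF nn_integral_square_le_weighted[OF g(1) lcst_trunc_measurable[OF det f, of R], of 1]])
    have "(\<integral>\<^sup>+z. ennreal ((norm (lcst_trunc a b c d R f z - g z))\<^sup>2) \<partial>lebesgue) < \<infinity>"
      using R by (rule order_less_trans) simp
    with fin show "ennreal (1 + 1) * (\<integral>\<^sup>+z. ennreal ((norm (lcst_trunc a b c d R f z))\<^sup>2) \<partial>lebesgue) +
        ennreal (1 + 1 / 1) * (\<integral>\<^sup>+z. ennreal ((norm (lcst_trunc a b c d R f z - g z))\<^sup>2) \<partial>lebesgue) < \<infinity>"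
      by (simp add: ennreal_mult_less_top)
  qed simp
  then have "L2 g"
    using g(1) by (simp add: L2_iff integrable_iff_bounded)
  then show ?thesis
    using lim that by (simp add: is_lcst_iff)
qed

lemma is_lcst_norm:
  assumes det: "a * d - b * c = 1" and f: "L2 f" and g: "is_lcst a b c d f g"
  shows "(\<integral>z. (norm (g z))\<^sup>2 \<partial>lebesgue) = 2 * pi * (\<integral>z. (norm (f z))\<^sup>2 \<partial>lebesgue)"
proof -
  have L2g: "L2 g" and lim: "((\<lambda>R. \<integral>\<^sup>+z. ennreal ((norm (lcst_trunc a b c d R f z - g z))\<^sup>2) \<partial>lebesgue) \<longlongrightarrow> 0) at_top"
    using g by (auto simp: is_lcst_iff)
  have "((\<lambda>R. \<integral>\<^sup>+z. ennreal ((norm (lcst_trunc a b c d R f z))\<^sup>2) \<partial>lebesgue) \<longlongrightarrow>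
      ennreal (2 * pi) * ennreal (\<integral>z. (norm (f z))\<^sup>2 \<partial>lebesgue)) at_top"
    unfolding lcst_trunc_eq lcst_op_isometry[OF det windowed_indicator[OF f]]
    by (intro tendsto_mult_ennreal tendsto_const nn_integral_window_tendsto(1) f) auto
  with lim have "(\<integral>\<^sup>+z. ennreal ((norm (g z))\<^sup>2) \<partial>lebesgue) = ennreal (2 * pi) * ennreal (\<integral>z. (norm (f z))\<^sup>2 \<partial>lebesgue)"
    using L2g lcst_trunc_measurable[OF det f] by (intro L2_norm_limit) (auto simp: L2_iff)
  then show ?thesis
    by (simp add: L2_nn_integral[OF L2g] ennreal_mult'[symmetric])
qed

lemma is_lcst_add:
  assumes det: "a * d - b * c = 1" and f: "L2 f1" "L2 f2" and g: "is_lcst a b c d f1 g1" "is_lcst a b c d f2 g2"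
  shows "is_lcst a b c d (\<lambda>z. f1 z + f2 z) (\<lambda>z. g1 z + g2 z)"
proof -
  let ?T = "\<lambda>R f. lcst_trunc a b c d R f" and ?N = "\<lambda>h::stvec \<Rightarrow> cl31. \<integral>\<^sup>+z. ennreal ((norm (h z))\<^sup>2) \<partial>lebesgue"
  have meas[measurable]: "?T R f1 \<in> borel_measurable lebesgue" "?T R f2 \<in> borel_measurable lebesgue"
    "g1 \<in> borel_measurable lebesgue" "g2 \<in> borel_measurable lebesgue" for R
    using f g by (auto simp: lcst_trunc_measurable[OF det] is_lcst_iff L2_iff)
  have le: "?N (\<lambda>z. ?T R (\<lambda>z. f1 z + f2 z) z - (g1 z + g2 z)) \<le>
      2 * ?N (\<lambda>z. ?T R f1 z - g1 z) + 2 * ?N (\<lambda>z. ?T R f2 z - g2 z)" for R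
  proof -
    \<comment> \<open>Additivity is drawn from \<open>lcst_op_diff\<close> by writing
      \<open>f1\<close> as the difference of \<open>f1 + f2\<close> and \<open>f2\<close>.\<close>
    have "AE z in lebesgue. ?T R (\<lambda>z. f1 z + f2 z) z - ?T R f2 z = ?T R f1 z"
      by (rule eventually_mono[OF lcst_op_diff[OF det windowed_indicator[OF L2_add[OF f], of b R] windowed_indicator[OF f(2), of b R]]])
        (simp add: lcst_trunc_eq scaleR_add_right)
    note AE = this
    have "?N (\<lambda>z. ?T R (\<lambda>z. f1 z + f2 z) z - (g1 z + g2 z)) = ?N (\<lambda>z. (?T R f1 z - g1 z) - (g2 z - ?T R f2 z))"
      by (rule nn_integral_cong_AE, rule eventually_mono[OF AE]) (simp add: algebra_simps)
    also have "\<dots> \<le> (\<integral>\<^sup>+z. 2 * ennreal ((norm (?T R f1 z - g1 z))\<^sup>2) + 2 * ennreal ((norm (?T R f2 z - g2 z))\<^sup>2) \<partial>lebesgue)"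
    proof (rule nn_integral_mono)
      fix z
      show "ennreal ((norm ((?T R f1 z - g1 z) - (g2 z - ?T R f2 z)))\<^sup>2) \<le>
          2 * ennreal ((norm (?T R f1 z - g1 z))\<^sup>2) + 2 * ennreal ((norm (?T R f2 z - g2 z))\<^sup>2)"
        using ennreal_leI[OF norm_diff_square_le[of "?T R f1 z - g1 z" "g2 z - ?T R f2 z"]]
        by (simp add: ennreal_plus ennreal_mult norm_minus_commute[of "g2 z"])
    qed
    also have "\<dots> = 2 * ?N (\<lambda>z. ?T R f1 z - g1 z) + 2 * ?N (\<lambda>z. ?T R f2 z - g2 z)"
      by (simp add: nn_integral_add nn_integral_cmult)
    finally show ?thesis .
  qed
  have lim: "((\<lambda>R. 2 * ?N (\<lambda>z. ?T R f1 z - g1 z) + 2 * ?N (\<lambda>z. ?T R f2 z - g2 z)) \<longlongrightarrow> 2 * 0 + 2 * 0) at_top"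
    using g by (intro tendsto_add tendsto_mult_ennreal tendsto_const) (auto simp: is_lcst_iff)
  have "((\<lambda>R. ?N (\<lambda>z. ?T R (\<lambda>z. f1 z + f2 z) z - (g1 z + g2 z))) \<longlongrightarrow> 0) at_top"
    using lim by (intro tendsto_sandwich[OF _ always_eventually tendsto_const lim[simplified]]) (simp, intro allI le)
  then show ?thesis
    using g by (simp add: is_lcst_iff L2_add)
qed

lemma L2_inner_polar:
  assumes "L2 f" "L2 g"
  shows "L2_inner f g = ((\<integral>z. (norm (f z + g z))\<^sup>2 \<partial>lebesgue) - (\<integral>z. (norm (f z))\<^sup>2 \<partial>lebesgue) - (\<integral>z. (norm (g z))\<^sup>2 \<partial>lebesgue)) / 2"
  using assms unfolding L2_inner_def cl_tr_mult_rev L2_iff by (intro integral_inner_polar(2)) auto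

theorem theorem3:
  fixes a b c d :: real and f1 f2 :: "stvec \<Rightarrow> cl31"
  assumes "a * d - b * c = 1" and "L2 f1" and "L2 f2"
  shows "\<exists>g1 g2. is_lcst a b c d f1 g1 \<and> is_lcst a b c d f2 g2 \<and>
           L2_inner g1 g2 = 2 * pi * L2_inner f1 f2"
proof -
  obtain g1 where g1: "is_lcst a b c d f1 g1" using is_lcst_exists[OF assms(1,2)] .
  obtain g2 where g2: "is_lcst a b c d f2 g2" using is_lcst_exists[OF assms(1,3)] .
  \<comment> \<open>The norm identity applies to \<open>f1 + f2\<close> as well, because
    \<open>is_lcst_add\<close> exhibits \<open>g1 + g2\<close> as its transform.\<close>
  have "L2_inner g1 g2 = 2 * pi * L2_inner f1 f2"
    using g1 g2 is_lcst_norm[OF assms(1,2) g1] is_lcst_norm[OF assms(1,3) g2]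
      is_lcst_norm[OF assms(1) L2_add[OF assms(2,3)] is_lcst_add[OF assms g1 g2]]
    by (simp add: L2_inner_polar assms is_lcst_iff algebra_simps diff_divide_distrib)
  with g1 g2 show ?thesis by blast
qed

end
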